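(* Let $N\ge1$ and let $\mathcal S_1,\dots,\mathcal S_t$ be pairwise disjoint subsets of $[N]$ with $|\mathcal S_j|=\ell_j$ and $\ell=\sum_j\ell_j$. Let $\sigma=p_1p_2$, where $p_1,p_2$ are independent, each uniformly random among the $(N-1)!$ cycles of length $N$ in $S_N$, and let $p(N,\vec\ell;2)$ be the probability that no cycle of $\sigma$ contains elements from two different sets $\mathcal S_i,\mathcal S_j$ ($i\neq j$). Then \[ p(N,\vec\ell;2)=\frac{(-1)^{N+\ell}N\prod_j\ell_j!}{(N)_\ell}\,[z^{N-\ell}]\,(1-z)^{-t+1}\int_0^1\frac{(1-u)^{N+1}u^{\ell-t}}{(1-u+zu)^{\ell+1}}\,du. \]
   Context: $[z^m]F(z)$ denotes the coefficient of $z^m$ in the power series expansion of $F$ at $z=0$. $(N)_\ell=N(N-1)\cdots(N-\ell+1)$.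
   Formalization: The sets S_j are assumed nonempty (with N=2, S_1={1,2}, S_2 empty the formula gives 2); as the function of z is not analytic at 0, its coefficient of z^{N-ℓ} is taken from its finite expansion as z→0+ with error o(z^{N-ℓ}). *)

theory Defs
  imports
    "HOL-Analysis.Analysis"
    "HOL-Probability.Probability"
    "HOL-Combinatorics.Combinatorics"
    "HOL-Library.Landau_Symbols"
begin

definition long_cycles :: "nat \<Rightarrow> (nat \<Rightarrow> nat) set"
  where "long_cycles N = {p. p permutes {1..N} \<and> cyclic_on p {1..N}}"

text \<open>For a permutation \<open>\<sigma>\<close> of \<open>{1..N}\<close>, the element sets of its cycles (fixed points
  included) are exactly the sets \<open>orbit \<sigma> x\<close> with \<open>x \<in> {1..N}\<close>.\<close>

definition separated :: "nat \<Rightarrow> nat \<Rightarrow> (nat \<Rightarrow> nat set) \<Rightarrow> (nat \<Rightarrow> nat) \<Rightarrow> bool"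
  where "separated N t S \<sigma> \<longleftrightarrow>
    (\<forall>x\<in>{1..N}. \<not> (\<exists>i\<in>{1..t}. \<exists>j\<in>{1..t}. i \<noteq> j \<and>
        orbit \<sigma> x \<inter> S i \<noteq> {} \<and> orbit \<sigma> x \<inter> S j \<noteq> {}))"

definition separation_prob :: "nat \<Rightarrow> nat \<Rightarrow> (nat \<Rightarrow> nat set) \<Rightarrow> real"
  where "separation_prob N t S =
    measure_pmf.prob (pair_pmf (pmf_of_set (long_cycles N)) (pmf_of_set (long_cycles N)))
      {(p1, p2). separated N t S (p1 \<circ> p2)}"

definition falling_factorial :: "real \<Rightarrow> nat \<Rightarrow> real"
  where "falling_factorial x k = (\<Prod>i<k. x - real i)"

text \<open>The coefficient of \<open>z ^ m\<close> in the expansion of \<open>F\<close> at 0. The function of \<open>z\<close> defined by the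
  integral in the theorem is not analytic at 0: the integral diverges for small \<open>z < 0\<close>, and for
  \<open>z \<rightarrow> 0+\<close> a term of the form \<open>z ^ (N - l + 1) * ln z\<close> appears. It does have an expansion
  in powers of \<open>z\<close> up to an error \<open>o(z ^ (N - l))\<close> for \<open>z \<rightarrow> 0+\<close>, which is just far enough for the
  coefficient needed. Hence the coefficient is taken from the finite expansion at \<open>0+\<close>. Such
  an expansion is unique, and if \<open>F\<close> has a convergent power series at 0, the coefficient is that
  of the power series (\<open>expansion_coeff_unique\<close>, \<open>expansion_coeff_has_fps_expansion\<close>).\<close>

definition has_expansion_coeff :: "(real \<Rightarrow> real) \<Rightarrow> nat \<Rightarrow> real \<Rightarrow> bool"
  where "has_expansion_coeff F m c \<longleftrightarrow>
    (\<exists>a. a m = c \<and> (\<lambda>z. F z - (\<Sum>k\<le>m. a k * z ^ k)) \<in> o[at_right 0](\<lambda>z. z ^ m))"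

definition expansion_coeff :: "nat \<Rightarrow> (real \<Rightarrow> real) \<Rightarrow> real"
  where "expansion_coeff m F = (THE c. has_expansion_coeff F m c)"

lemma poly_smallo_imp_zero:
  fixes d :: "nat \<Rightarrow> real"
  assumes "(\<lambda>z. \<Sum>k\<le>m. d k * z ^ k) \<in> o[at_right 0](\<lambda>z. z ^ m)"
  shows "k \<le> m \<Longrightarrow> d k = 0"
  using assms
proof (induction m arbitrary: d k)
  case 0
  have "((\<lambda>z::real. d 0) \<longlongrightarrow> 0) (at_right 0)"
    using smalloD_tendsto[OF 0(2)] by simp
  then have "d 0 = 0"
    by (simp add: tendsto_const_iff)
  with 0 show ?case by simp
next
  case (Suc m)
  have pos: "eventually (\<lambda>z::real. z > 0) (at_right 0)"
    by (simp add: eventually_at_right_less)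
  have lim: "((\<lambda>z::real. (\<Sum>k\<le>Suc m. d k * z ^ k) / z ^ Suc m) \<longlongrightarrow> 0) (at_right 0)"
    using smalloD_tendsto[OF Suc.prems(2)] .
  have "((\<lambda>z::real. z ^ Suc m) \<longlongrightarrow> 0 ^ Suc m) (at_right 0)"
    by (intro tendsto_intros)
  from tendsto_mult[OF lim this]
  have "((\<lambda>z::real. (\<Sum>k\<le>Suc m. d k * z ^ k) / z ^ Suc m * z ^ Suc m) \<longlongrightarrow> 0) (at_right 0)"
    by simp
  then have "((\<lambda>z::real. \<Sum>k\<le>Suc m. d k * z ^ k) \<longlongrightarrow> 0) (at_right 0)"
    by (rule Lim_transform_eventually) (use pos in eventually_elim, simp)
  moreover have "((\<lambda>z::real. \<Sum>k\<le>Suc m. d k * z ^ k) \<longlongrightarrow> (\<Sum>k\<le>Suc m. d k * 0 ^ k)) (at_right 0)"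
    by (intro tendsto_intros)
  ultimately have "(\<Sum>k\<le>Suc m. d k * 0 ^ k) = 0"
    using tendsto_unique trivial_limit_at_right_real by blast
  then have d0: "d 0 = 0"
    by (subst (asm) sum.atMost_Suc_shift) simp
  have eq: "(\<Sum>k\<le>Suc m. d k * z ^ k) = z * (\<Sum>k\<le>m. d (Suc k) * z ^ k)" for z :: real
    by (subst sum.atMost_Suc_shift) (simp add: d0 sum_distrib_left algebra_simps)
  have "((\<lambda>z::real. (\<Sum>k\<le>m. d (Suc k) * z ^ k) / z ^ m) \<longlongrightarrow> 0) (at_right 0)"
    by (rule Lim_transform_eventually[OF lim]) (use pos in eventually_elim, simp only: eq, simp)
  then have "(\<lambda>z. \<Sum>k\<le>m. d (Suc k) * z ^ k) \<in> o[at_right 0](\<lambda>z. z ^ m)"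
    by (rule smalloI_tendsto) (use pos in eventually_elim, simp)
  from Suc.IH[OF _ this] have "d (Suc k) = 0" if "k \<le> m" for k
    using that by blast
  with d0 Suc.prems(1) show ?case
    by (cases k) auto
qed

lemma expansion_coeff_unique:
  assumes "has_expansion_coeff F m c" "has_expansion_coeff F m c'"
  shows "c = c'"
proof -
  obtain a where a: "a m = c" "(\<lambda>z. F z - (\<Sum>k\<le>m. a k * z ^ k)) \<in> o[at_right 0](\<lambda>z. z ^ m)"
    using assms(1) unfolding has_expansion_coeff_def by blast
  obtain b where b: "b m = c'" "(\<lambda>z. F z - (\<Sum>k\<le>m. b k * z ^ k)) \<in> o[at_right 0](\<lambda>z. z ^ m)"
    using assms(2) unfolding has_expansion_coeff_def by blast
  have "(\<lambda>z. \<Sum>k\<le>m. (b k - a k) * z ^ k) \<in> o[at_right 0](\<lambda>z. z ^ m)"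
    using sum_in_smallo(2)[OF a(2) b(2)]
    by (simp add: algebra_simps sum_subtractf)
  from poly_smallo_imp_zero[OF this order.refl] show ?thesis
    using a b by simp
qed

lemma expansion_coeff_eqI: "has_expansion_coeff F m c \<Longrightarrow> expansion_coeff m F = c"
  unfolding expansion_coeff_def using expansion_coeff_unique by blast

lemma expansion_coeff_has_fps_expansion:
  assumes "F has_fps_expansion A"
  shows "has_expansion_coeff F m (fps_nth A m)" "expansion_coeff m F = fps_nth A m"
proof -
  define G where "G = fps_shift (Suc m) A"
  have r: "fps_conv_radius A > 0" and ev: "eventually (\<lambda>z. eval_fps A z = F z) (nhds 0)"
    using assms by (auto simp: has_fps_expansion_def)
  have rG: "fps_conv_radius G > 0"
    using r by (simp add: G_def)
  have pos: "eventually (\<lambda>z::real. z > 0) (at_right 0)"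
    by (simp add: eventually_at_right_less)
  have at0: "at_right (0::real) \<le> nhds 0"
    by (simp add: at_within_def)
  have inr: "eventually (\<lambda>z::real. ereal (norm z) < fps_conv_radius A) (nhds 0)"
    using eventually_nhds_in_open[of "eball 0 (fps_conv_radius A)" "0::real"] r
    by (simp add: zero_ereal_def in_eball_iff)
  have split: "eventually (\<lambda>z. F z - (\<Sum>k\<le>m. fps_nth A k * z ^ k) = z ^ Suc m * eval_fps G z) (at_right 0)"
    using filter_leD[OF at0 ev] filter_leD[OF at0 inr]
  proof eventually_elim
    case (elim z)
    have s: "summable (\<lambda>n. fps_nth A n * z ^ n)"
      using elim(2) by (intro summable_fps) auto
    have sG: "summable (\<lambda>n. fps_nth G n * z ^ n)"
      using elim(2) by (intro summable_fps) (auto simp: G_def)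
    have "eval_fps A z = (\<Sum>n. fps_nth A (n + Suc m) * z ^ (n + Suc m)) + (\<Sum>k<Suc m. fps_nth A k * z ^ k)"
      unfolding eval_fps_def by (rule suminf_split_initial_segment[OF s])
    also have "(\<Sum>n. fps_nth A (n + Suc m) * z ^ (n + Suc m)) = (\<Sum>n. z ^ Suc m * (fps_nth G n * z ^ n))"
      by (simp add: G_def power_add algebra_simps)
    also have "\<dots> = z ^ Suc m * eval_fps G z"
      unfolding eval_fps_def by (rule suminf_mult[OF sG])
    finally show ?case
      using elim(1) by (simp add: lessThan_Suc_atMost)
  qed
  have "isCont (eval_fps G) 0"
    using rG by (intro continuous_eval_fps) (auto simp: zero_ereal_def)
  then have "(eval_fps G \<longlongrightarrow> eval_fps G 0) (at_right 0)"
    unfolding isCont_def by (rule filterlim_mono) (auto simp: at_le)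
  then have "((\<lambda>z::real. z * eval_fps G z) \<longlongrightarrow> 0 * eval_fps G 0) (at_right 0)"
    by (intro tendsto_intros)
  then have "((\<lambda>z. (F z - (\<Sum>k\<le>m. fps_nth A k * z ^ k)) / z ^ m) \<longlongrightarrow> 0) (at_right 0)"
    unfolding mult_zero_left
    by (rule Lim_transform_eventually) (use pos split in eventually_elim, simp)
  then have "(\<lambda>z. F z - (\<Sum>k\<le>m. fps_nth A k * z ^ k)) \<in> o[at_right 0](\<lambda>z. z ^ m)"
    by (rule smalloI_tendsto) (use pos in eventually_elim, simp)
  then show *: "has_expansion_coeff F m (fps_nth A m)"
    unfolding has_expansion_coeff_def by blast
  then show "expansion_coeff m F = fps_nth A m"
    by (rule expansion_coeff_eqI)
qed

end

theory Submission
  imports Defs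
begin

text \<open>A full cycle on \<open>A \<union> {x}\<close> is uniquely \<open>(x a) p\<close> with \<open>a \<in> A\<close> and \<open>p\<close> a full cycle on \<open>A\<close>.
  This gives a recurrence for the number of factorisations of \<open>\<sigma>\<close> into two full cycles, and induction
  on \<open>n = |A|\<close> yields
  \<open>n (n + 1) \<cdot> #{(p, q). p q = \<sigma>} = \<Sum> sgn(\<sigma> restricted to Y) |Y|! (n - |Y|)!\<close>,
  summed over the \<open>\<sigma>\<close>-invariant sets \<open>Y\<close>. In the induction step, the sets that are invariant under
  \<open>(i a) \<sigma>\<close> and contain only one of \<open>i\<close> and \<open>a\<close> contribute a telescoping sum.

  Summing over the separating \<open>\<sigma>\<close> first, for fixed \<open>Y\<close>, and inserting the elements one after another
  into the cycles, each element contributes a linear factor. With \<open>|Y|! (N - |Y|)!\<close> written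
  as a Beta integral of \<open>(1 - u) ^ (N - |Y|) u ^ |Y|\<close>, the sum over \<open>Y\<close> becomes, for every \<open>u\<close>, the
  coefficient of \<open>z ^ (N - l)\<close> in \<open>(1 - (1 - u) z) ^ (- l - 1) (1 + u z) ^ (1 - t)\<close> times
  \<open>(1 - u) ^ (l - t) (N - l)! \<Prod> (l_j)!\<close>. The substitutions \<open>u \<rightarrow> 1 - u\<close> and \<open>z \<rightarrow> - u z\<close> relate it
  to the integrand of the theorem; formally, both sides are compared as finite sums of Beta values.\<close>

subsection \<open>Full cycles and their products\<close>

text \<open>The sum over invariant sets comes from representation theory. In Frobenius' formula for
  the number of factorisations only hook shapes contribute, because all other characters vanish on a
  full cycle. The hook with leg length k has value (-1)^k there and degree binomial(n - 1, k); the
  generating function of the hook characters is, up to a factor 1 + q, the product of 1 - (-q)^r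
  over the cycle lengths r. Writing the reciprocal binomial coefficients as Beta integrals gives (n
  - 1)! times the integral over [0, 1] of the product of (1 - u)^r - (-u)^r, and expanding this
  product leads to the sum. Once the formula is known, no characters are needed: the recurrence
  verifies it. The obstacle is that for a moved element the recurrence runs over many permutations
  (i a) p, whose invariant sets differ from those of p. On the analytic side, the substitution for z
  depends on the integration variable and the integral has only a finite expansion at 0+, so the
  substitution serves as a guide and is not carried out.\<close>

abbreviation transp :: "'a \<Rightarrow> 'a \<Rightarrow> 'a \<Rightarrow> 'a"
  where "transp \<equiv> Transposition.transpose"

definition full_cycles :: "'a set \<Rightarrow> ('a \<Rightarrow> 'a) set"
  where "full_cycles A = {p. p permutes A \<and> cyclic_on p A}"

text \<open>For \<open>p\<close> permuting a finite \<open>A\<close> these are the unions of cycles,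
  so a sum over them expands a product over the cycles.\<close>

definition invariant_sets :: "'a set \<Rightarrow> ('a \<Rightarrow> 'a) \<Rightarrow> 'a set set"
  where "invariant_sets A p = {Y. Y \<subseteq> A \<and> p ` Y = Y}"

lemma finite_invariant_sets [simp]: "finite A \<Longrightarrow> finite (invariant_sets A p)"
  by (simp add: invariant_sets_def)

lemma full_cycles_permutes: "p \<in> full_cycles A \<Longrightarrow> p permutes A"
  by (simp add: full_cycles_def)

lemma finite_full_cycles [simp]: "finite A \<Longrightarrow> finite (full_cycles A)"
  by (rule finite_subset[OF _ finite_permutations]) (auto simp: full_cycles_def)

lemma permutes_insert_transpose:
  assumes "p permutes A" "a \<in> insert x A"
  shows "transp x a \<circ> p permutes insert x A"
  using assms by (intro permutes_compose permutes_swap_id permutes_imp_permutes_insert) auto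

text \<open>A transposition is an involution; moving it to the other side turns invariance into a
  condition on the image under \<open>p\<close> alone.\<close>

lemma image_comp_transpose_eq_iff:
  "(transp x i \<circ> p) ` Y = Z \<longleftrightarrow> p ` Y = transp x i ` Z"
proof -
  have inv: "transp x i ` transp x i ` W = W" for W
    by (simp add: image_comp)
  show ?thesis
    unfolding image_comp[symmetric] using inv by metis
qed

lemma transpose_image_move: "i \<in> Y \<Longrightarrow> x \<notin> Y \<Longrightarrow> transp x i ` Y = insert x (Y - {i})"
  by (auto simp: in_transpose_image_iff image_iff Transposition.transpose_def)

lemma image_subset_permutes: "p permutes A \<Longrightarrow> Y \<subseteq> A \<Longrightarrow> p ` Y \<subseteq> A"
  using permutes_image by blast

text \<open>Neither \<open>Y\<close> nor its image under \<open>p\<close> contains \<open>x\<close>,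
  but swapping would bring \<open>x\<close> in if \<open>i\<close> were in \<open>Y\<close>. The
  case \<open>i = x\<close>, where the transposition is the identity, is included and serves for
  adding a fixed point.\<close>

lemma invariant_transpose_iff:
  assumes "p permutes A" "x \<notin> A" "Y \<subseteq> A"
  shows "(transp x i \<circ> p) ` Y = Y \<longleftrightarrow> p ` Y = Y \<and> i \<notin> Y"
proof (cases "i \<in> Y")
  case True
  have "x \<notin> Y" "x \<notin> p ` Y"
    using assms image_subset_permutes[of p A Y] by auto
  with True show ?thesis
    unfolding image_comp_transpose_eq_iff by (auto simp: transpose_image_move)
next
  case False
  moreover have "x \<notin> Y"
    using assms by auto
  ultimately show ?thesis
    unfolding image_comp_transpose_eq_iff by simp
qed

lemma invariant_insert_transpose_iff:
  assumes "p permutes A" "x \<notin> A" "Y \<subseteq> A"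
  shows "(transp x i \<circ> p) ` insert x Y = insert x Y \<longleftrightarrow> p ` Y = Y \<and> i \<in> insert x Y"
proof -
  have x: "x \<notin> Y" "x \<notin> p ` Y" "p x = x"
    using assms image_subset_permutes[of p A Y] by (auto simp: permutes_not_in)
  show ?thesis
  proof (cases "i \<in> insert x Y")
    case True
    then have "transp x i ` insert x Y = insert x Y"
      by (intro transpose_image_eq) auto
    with True x show ?thesis
      unfolding image_comp_transpose_eq_iff by (simp add: insert_ident)
  next
    case False
    then have "x \<notin> transp x i ` insert x Y"
      by (auto simp: in_transpose_image_iff)
    with False x show ?thesis
      unfolding image_comp_transpose_eq_iff by auto
  qed
qed

text \<open>Cyclicity is recast as the absence of proper invariant sets, which can be followed
  through a composition with a transposition. For the converse, the orbit of a point is mapped into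
  itself, hence onto itself by finiteness and injectivity.\<close>

lemma full_cycles_iff:
  assumes "finite A" "A \<noteq> {}"
  shows "p \<in> full_cycles A \<longleftrightarrow> p permutes A \<and> invariant_sets A p \<subseteq> {{}, A}"
proof (cases "p permutes A")
  case perm: True
  have clos: "orbit p y \<subseteq> Y" if "p ` Y = Y" "y \<in> Y" for y Y
  proof
    fix z assume "z \<in> orbit p y"
    then show "z \<in> Y"
      by induction (use that in auto)
  qed
  have pp: "permutation p"
    using perm assms permutes_imp_permutation by blast
  show ?thesis
  proof
    assume "p \<in> full_cycles A"
    then have cyc: "cyclic_on p A"
      by (simp add: full_cycles_def)
    have "Y = A" if "Y \<subseteq> A" "p ` Y = Y" "Y \<noteq> {}" for Y
    proof -
      from that obtain y where y: "y \<in> Y" by blast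
      with that have "orbit p y = A"
        using orbit_cyclic_eq3[OF cyc] by blast
      with clos[OF that(2) y] that(1) show ?thesis by simp
    qed
    then show "p permutes A \<and> invariant_sets A p \<subseteq> {{}, A}"
      using perm by (auto simp: invariant_sets_def)
  next
    assume R: "p permutes A \<and> invariant_sets A p \<subseteq> {{}, A}"
    obtain a where a: "a \<in> A" using assms by blast
    have sub: "orbit p a \<subseteq> A"
      using permutes_orbit_subset[OF perm a] .
    have "p ` orbit p a \<subseteq> orbit p a"
      by (auto intro: orbit.step)
    moreover have "finite (orbit p a)"
      using sub assms finite_subset by blast
    moreover have "inj_on p (orbit p a)"
      using perm permutes_inj_on by blast
    ultimately have "p ` orbit p a = orbit p a"
      by (simp add: endo_inj_surj)
    with sub R have "orbit p a \<in> {{}, A}"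
      by (auto simp: invariant_sets_def)
    with a show "p \<in> full_cycles A"
      using perm orbit_nonempty by (fastforce simp: full_cycles_def cyclic_on_def)
  qed
qed (simp add: full_cycles_def)

text \<open>The composition splices \<open>x\<close> into the cycle of \<open>a\<close>, directly
  before \<open>a\<close>. Invariant sets correspond: those containing \<open>a\<close> receive
  \<open>x\<close>, the others stay as they are.\<close>

lemma transpose_full_cycle_iff:
  assumes "finite A" "x \<notin> A" "a \<in> A" "p permutes A"
  shows "transp x a \<circ> p \<in> full_cycles (insert x A) \<longleftrightarrow> p \<in> full_cycles A"
proof -
  let ?q = "transp x a \<circ> p"
  have ne: "A \<noteq> {}" using assms by auto
  have "invariant_sets (insert x A) ?q \<subseteq> {{}, insert x A} \<longleftrightarrow> invariant_sets A p \<subseteq> {{}, A}"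
  proof
    assume L: "invariant_sets (insert x A) ?q \<subseteq> {{}, insert x A}"
    show "invariant_sets A p \<subseteq> {{}, A}"
    proof
      fix Y assume "Y \<in> invariant_sets A p"
      then have Y: "Y \<subseteq> A" "p ` Y = Y" by (auto simp: invariant_sets_def)
      show "Y \<in> {{}, A}"
      proof (cases "a \<in> Y")
        case True
        then have "insert x Y \<in> invariant_sets (insert x A) ?q"
          using Y invariant_insert_transpose_iff[OF assms(4,2) Y(1), of a]
          by (auto simp: invariant_sets_def simp del: image_insert)
        with L Y assms show ?thesis
          by (auto simp: insert_ident)
      next
        case False
        then have "Y \<in> invariant_sets (insert x A) ?q"
          using Y invariant_transpose_iff[OF assms(4,2) Y(1), of a]
          by (auto simp: invariant_sets_def)
        with L Y assms show ?thesis by auto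
      qed
    qed
  next
    assume R: "invariant_sets A p \<subseteq> {{}, A}"
    show "invariant_sets (insert x A) ?q \<subseteq> {{}, insert x A}"
    proof
      fix Y assume "Y \<in> invariant_sets (insert x A) ?q"
      then have Y: "Y \<subseteq> insert x A" "?q ` Y = Y" by (auto simp: invariant_sets_def)
      show "Y \<in> {{}, insert x A}"
      proof (cases "x \<in> Y")
        case True
        define W where "W = Y - {x}"
        have W: "Y = insert x W" "W \<subseteq> A" using True Y by (auto simp: W_def)
        with Y(2) have "p ` W = W" "a \<in> insert x W"
          using invariant_insert_transpose_iff[OF assms(4,2) W(2), of a] by auto
        with R W assms(2,3) show ?thesis
          by (auto simp: invariant_sets_def)
      next
        case False
        then have YA: "Y \<subseteq> A" using Y by auto
        with Y(2) have "p ` Y = Y" "a \<notin> Y"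
          using invariant_transpose_iff[OF assms(4,2) YA, of a] by auto
        with R YA assms(3) show ?thesis
          by (auto simp: invariant_sets_def)
      qed
    qed
  qed
  moreover have "?q permutes insert x A"
    using assms by (intro permutes_insert_transpose) auto
  ultimately show ?thesis
    using assms ne by (simp add: full_cycles_iff)
qed

text \<open>A full cycle on at least two points moves \<open>x\<close>, since otherwise the
  singleton of \<open>x\<close> would be invariant. So \<open>a\<close> can be read off as the image
  of \<open>x\<close>, and the transposition undone.\<close>

lemma bij_betw_full_cycles_insert:
  assumes "finite A" "A \<noteq> {}" "x \<notin> A"
  shows "bij_betw (\<lambda>(a, p). transp x a \<circ> p) (A \<times> full_cycles A) (full_cycles (insert x A))"
proof (rule bij_betw_byWitness[where f' = "\<lambda>q. (q x, transp x (q x) \<circ> q)"])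
  have fix_x: "p x = x" if "p \<in> full_cycles A" for p
    using that assms(3) full_cycles_permutes permutes_not_in by metis
  show "\<forall>ap\<in>A \<times> full_cycles A.
      (\<lambda>q. (q x, transp x (q x) \<circ> q)) ((\<lambda>(a, p). transp x a \<circ> p) ap) = ap"
    by (auto simp: fix_x o_assoc[symmetric] fun_eq_iff)
  show "\<forall>q\<in>full_cycles (insert x A).
      (\<lambda>(a, p). transp x a \<circ> p) (q x, transp x (q x) \<circ> q) = q"
    by (auto simp: fun_eq_iff)
  show "(\<lambda>(a, p). transp x a \<circ> p) ` (A \<times> full_cycles A) \<subseteq> full_cycles (insert x A)"
    using assms transpose_full_cycle_iff full_cycles_permutes by fastforce
  show "(\<lambda>q. (q x, transp x (q x) \<circ> q)) ` full_cycles (insert x A) \<subseteq> A \<times> full_cycles A"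
  proof clarify
    fix q assume q: "q \<in> full_cycles (insert x A)"
    have qp: "q permutes insert x A"
      using q full_cycles_permutes by blast
    have "q x \<noteq> x"
    proof
      assume "q x = x"
      then have "{x} \<in> invariant_sets (insert x A) q"
        by (auto simp: invariant_sets_def)
      with q assms show False
        by (auto simp: full_cycles_iff)
    qed
    then have qx: "q x \<in> A"
      using permutes_in_image[OF qp, of x] by auto
    have p: "transp x (q x) \<circ> q permutes A"
      using permutes_insert_lemma[OF qp] .
    have "transp x (q x) \<circ> (transp x (q x) \<circ> q) = q"
      by (simp add: fun_eq_iff)
    with q show "q x \<in> A \<and> transp x (q x) \<circ> q \<in> full_cycles A"
      using transpose_full_cycle_iff[OF assms(1,3) qx p] qx by simp
  qed
qed

lemma sum_full_cycles_insert:
  assumes "finite A" "A \<noteq> {}" "x \<notin> A"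
  shows "sum f (full_cycles (insert x A)) = (\<Sum>a\<in>A. \<Sum>p\<in>full_cycles A. f (transp x a \<circ> p))"
  using sum.reindex_bij_betw[OF bij_betw_full_cycles_insert[OF assms], of f, symmetric]
  by (simp add: sum.cartesian_product case_prod_unfold)

lemma full_cycles_singleton: "full_cycles {x} = {id}"
proof -
  have "id \<in> full_cycles {x}"
    by (auto simp: full_cycles_iff invariant_sets_def)
  then show ?thesis
    by (auto simp: full_cycles_def permutes_def fun_eq_iff) metis
qed

lemma card_full_cycles:
  assumes "finite A" "A \<noteq> {}"
  shows "card (full_cycles A) = fact (card A - 1)"
  using assms
proof (induction rule: finite_ne_induct)
  case (insert x F)
  then show ?case
    using bij_betw_same_card[OF bij_betw_full_cycles_insert[of F x]]
    by (cases "card F") (auto simp: card_cartesian_product)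
qed (simp add: full_cycles_singleton)

definition cycle_pairs :: "'a set \<Rightarrow> ('a \<Rightarrow> 'a) \<Rightarrow> nat"
  where "cycle_pairs A \<sigma> = card {(p, q). p \<in> full_cycles A \<and> q \<in> full_cycles A \<and> p \<circ> q = \<sigma>}"

lemma cycle_pairs_sum:
  assumes "finite A"
  shows "cycle_pairs A \<sigma> = (\<Sum>p\<in>full_cycles A. \<Sum>q\<in>full_cycles A. of_bool (p \<circ> q = \<sigma>))"
proof -
  have "{(p, q). p \<in> full_cycles A \<and> q \<in> full_cycles A \<and> p \<circ> q = \<sigma>} =
    (full_cycles A \<times> full_cycles A) \<inter> {(p, q). p \<circ> q = \<sigma>}" by auto
  then have "cycle_pairs A \<sigma> = (\<Sum>z\<in>full_cycles A \<times> full_cycles A. of_bool (fst z \<circ> snd z = \<sigma>))"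
    using assms by (simp add: cycle_pairs_def case_prod_unfold)
  then show ?thesis
    by (simp add: sum.cartesian_product case_prod_unfold)
qed

text \<open>This removes most terms of the recurrence, namely those whose argument still moves the
  inserted point.\<close>

lemma cycle_pairs_not_permutes:
  assumes "\<not> \<sigma> permutes A"
  shows "cycle_pairs A \<sigma> = 0"
proof -
  have "{(p, q). p \<in> full_cycles A \<and> q \<in> full_cycles A \<and> p \<circ> q = \<sigma>} = {}"
    using assms permutes_compose full_cycles_permutes by blast
  then show ?thesis
    unfolding cycle_pairs_def by (metis card.empty)
qed

text \<open>Moving the second transposition in \<open>(x a) p (x b) q\<close> to the left turns it into
  \<open>(x a) (x (p b)) p q\<close>.\<close>

lemma cycle_pairs_insert:
  assumes "finite A" "A \<noteq> {}" "x \<notin> A"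
  shows "cycle_pairs (insert x A) \<sigma> =
    (\<Sum>a\<in>A. \<Sum>b\<in>A. cycle_pairs A (transp x b \<circ> (transp x a \<circ> \<sigma>)))"
proof -
  let ?C = "full_cycles A"
  have move: "(transp x a \<circ> p) \<circ> (transp x b \<circ> q) = \<sigma> \<longleftrightarrow>
      p \<circ> q = transp x (p b) \<circ> (transp x a \<circ> \<sigma>)" if "p \<in> ?C" for a b p q
  proof -
    have p: "p permutes A" using that full_cycles_permutes by blast
    then have px: "p x = x" using assms permutes_not_in by metis
    have inj: "p u = p v \<longleftrightarrow> u = v" for u v
      using permutes_inj[OF p] by (simp add: inj_eq)
    have "p \<circ> transp x b = transp x (p b) \<circ> p"
      using inj[of _ x] inj[of _ b] px by (auto simp: fun_eq_iff Transposition.transpose_def)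
    then have eq: "(transp x a \<circ> p) \<circ> (transp x b \<circ> q) =
        transp x a \<circ> (transp x (p b) \<circ> (p \<circ> q))"
      by (metis o_assoc)
    show ?thesis unfolding eq
      by (metis o_assoc transpose_comp_involutory id_comp)
  qed
  have "cycle_pairs (insert x A) \<sigma> = (\<Sum>a\<in>A. \<Sum>p\<in>?C. \<Sum>b\<in>A. \<Sum>q\<in>?C.
      of_bool ((transp x a \<circ> p) \<circ> (transp x b \<circ> q) = \<sigma>))"
    unfolding cycle_pairs_sum[OF finite.insertI[OF assms(1)]] sum_full_cycles_insert[OF assms] ..
  also have "\<dots> = (\<Sum>a\<in>A. \<Sum>p\<in>?C. \<Sum>b\<in>A. \<Sum>q\<in>?C.
      of_bool (p \<circ> q = transp x (p b) \<circ> (transp x a \<circ> \<sigma>)))"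
    by (intro sum.cong refl arg_cong[where f = of_bool] move)
  \<comment> \<open>For fixed \<open>p\<close>, the point \<open>p b\<close> runs through
    \<open>A\<close> together with \<open>b\<close>; after reindexing the right factor no longer
    depends on \<open>p\<close>.\<close>
  also have "\<dots> = (\<Sum>a\<in>A. \<Sum>p\<in>?C. \<Sum>b\<in>A. \<Sum>q\<in>?C.
      of_bool (p \<circ> q = transp x b \<circ> (transp x a \<circ> \<sigma>)))"
  proof (rule sum.cong[OF refl], rule sum.cong[OF refl])
    fix a p assume p: "p \<in> ?C"
    have "bij_betw p A A"
      using full_cycles_permutes[OF p] permutes_imp_bij by blast
    then show "(\<Sum>b\<in>A. \<Sum>q\<in>?C. of_bool (p \<circ> q = transp x (p b) \<circ> (transp x a \<circ> \<sigma>))) =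
      (\<Sum>b\<in>A. \<Sum>q\<in>?C. of_bool (p \<circ> q = transp x b \<circ> (transp x a \<circ> \<sigma>)) :: nat)"
      by (rule sum.reindex_bij_betw)
  qed
  also have "\<dots> = (\<Sum>a\<in>A. \<Sum>b\<in>A. \<Sum>p\<in>?C. \<Sum>q\<in>?C.
      of_bool (p \<circ> q = transp x b \<circ> (transp x a \<circ> \<sigma>)))"
    by (rule sum.cong[OF refl], rule sum.swap)
  finally show ?thesis
    using assms by (simp add: cycle_pairs_sum)
qed

subsection \<open>The number of factorisations into two full cycles\<close>

lemma sign_on_fixpoint:
  assumes "p x = x"
  shows "sign_on (insert x Y) p = sign_on Y p"
proof -
  have "restrict_id p (insert x Y) = restrict_id p Y"
    using assms by (auto simp: restrict_id_def fun_eq_iff)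
  then show ?thesis
    by (simp add: sign_on_def)
qed

lemma sign_on_transpose_comp:
  assumes "finite Y" "bij_betw p Y Y" "x \<in> Y" "i \<in> Y"
  shows "sign_on Y (transp x i \<circ> p) = (if x = i then 1 else - 1) * sign_on Y p"
  using assms sign_on_compose[of "transp x i" Y p] sign_on_transpose[of x Y i] by auto

text \<open>\<open>p\<close> is the product of its restrictions to \<open>Y\<close> and to the
  complement, and signs are their own inverses.\<close>

lemma sign_on_complement:
  assumes "finite A" "p permutes A" "Y \<subseteq> A" "p ` Y = Y"
  shows "sign_on (A - Y) p = sign p * sign_on Y p"
proof -
  have inj: "inj_on p Z" for Z
    using assms(2) permutes_inj_on by blast
  have "p ` (A - Y) = A - Y"
    using assms inj by (simp add: inj_on_image_set_diff[OF inj[of A]] permutes_image)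
  then have b: "bij_betw p Y Y" "bij_betw p (A - Y) (A - Y)"
    using inj assms(4) by (auto simp: bij_betw_def)
  have fin: "finite Y" "finite (A - Y)"
    using assms finite_subset by auto
  have perm: "permutation (restrict_id p Y)" "permutation (restrict_id p (A - Y))"
    using permutes_imp_permutation[OF fin(1) permutes_restrict_id[OF b(1)]]
      permutes_imp_permutation[OF fin(2) permutes_restrict_id[OF b(2)]] by simp_all
  have "p = restrict_id p Y \<circ> restrict_id p (A - Y)"
  proof
    fix z
    show "p z = (restrict_id p Y \<circ> restrict_id p (A - Y)) z"
      using assms b by (cases "z \<in> Y"; cases "z \<in> A")
        (auto simp: restrict_id_def permutes_not_in bij_betw_def)
  qed
  then have "sign p = sign_on Y p * sign_on (A - Y) p"
    using sign_compose[OF perm] by (simp add: sign_on_def)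
  then show ?thesis
    by (metis mult.assoc mult.commute mult_1 sign_idempotent sign_on_def)
qed

lemma bij_betw_invariant: "p permutes A \<Longrightarrow> p ` Y = Y \<Longrightarrow> bij_betw p Y Y"
  using permutes_inj_on by (auto simp: bij_betw_def)

lemma invariant_complement:
  assumes "p permutes A" "Y \<subseteq> A" "p ` Y = Y"
  shows "p ` (A - Y) = A - Y"
  using assms permutes_inj_on[OF assms(1), of A]
  by (simp add: inj_on_image_set_diff[OF permutes_inj_on[OF assms(1), of A]] permutes_image)

text \<open>The two sums correspond to leaving \<open>x\<close> out and to taking it in. For
  \<open>i\<close> in \<open>A\<close> exactly one of the two terms survives for each
  \<open>Y\<close>; for \<open>i = x\<close> both do.\<close>

lemma sum_invariant_sets_insert:
  fixes f :: "'a set \<Rightarrow> 'b :: comm_monoid_add"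
  assumes "finite A" "x \<notin> A" "p permutes A"
  shows "sum f (invariant_sets (insert x A) (transp x i \<circ> p)) =
    (\<Sum>Y\<in>invariant_sets A p. if i \<in> Y then 0 else f Y) +
    (\<Sum>Y\<in>invariant_sets A p. if i \<in> insert x Y then f (insert x Y) else 0)"
proof -
  let ?I = "invariant_sets A p"
  let ?P = "{Y \<in> ?I. i \<notin> Y}" and ?Q = "{Y \<in> ?I. i \<in> insert x Y}"
  have eq: "invariant_sets (insert x A) (transp x i \<circ> p) = ?P \<union> insert x ` ?Q"
  proof (intro set_eqI iffI)
    fix Y assume "Y \<in> invariant_sets (insert x A) (transp x i \<circ> p)"
    then have Y: "Y \<subseteq> insert x A" "(transp x i \<circ> p) ` Y = Y"
      by (auto simp: invariant_sets_def)
    show "Y \<in> ?P \<union> insert x ` ?Q"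
    proof (cases "x \<in> Y")
      case True
      then have W: "Y = insert x (Y - {x})" "Y - {x} \<subseteq> A" using Y by auto
      with Y(2) have "Y - {x} \<in> ?Q"
        using invariant_insert_transpose_iff[OF assms(3,2) W(2), of i]
        by (simp add: invariant_sets_def)
      with W show ?thesis by blast
    next
      case False
      then have "Y \<subseteq> A" using Y by auto
      with Y(2) show ?thesis
        using invariant_transpose_iff[OF assms(3,2), of Y i] by (simp add: invariant_sets_def)
    qed
  next
    fix Y assume "Y \<in> ?P \<union> insert x ` ?Q"
    then consider "Y \<in> ?P" | W where "W \<in> ?Q" "Y = insert x W" by blast
    then show "Y \<in> invariant_sets (insert x A) (transp x i \<circ> p)"
    proof cases
      case 1
      then show ?thesis
        using invariant_transpose_iff[OF assms(3,2), of Y i] by (auto simp: invariant_sets_def)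
    next
      case 2
      then show ?thesis
        using invariant_insert_transpose_iff[OF assms(3,2), of W i]
        by (auto simp: invariant_sets_def simp del: image_insert)
    qed
  qed
  have "inj_on (insert x) ?Q"
    using assms(2) by (intro inj_onI) (auto simp: invariant_sets_def insert_ident subset_iff)
  moreover have "?P \<inter> insert x ` ?Q = {}"
    using assms(2) by (auto simp: invariant_sets_def)
  ultimately have "sum f (invariant_sets (insert x A) (transp x i \<circ> p)) =
      sum f ?P + (\<Sum>Y\<in>?Q. f (insert x Y))"
    unfolding eq using assms(1) by (subst sum.union_disjoint) (auto simp: sum.reindex)
  moreover have "sum f ?P = (\<Sum>Y\<in>?I. if i \<in> Y then 0 else f Y)"
    using assms(1) by (subst sum.inter_filter) (auto intro!: sum.cong)
  moreover have "(\<Sum>Y\<in>?Q. f (insert x Y)) = (\<Sum>Y\<in>?I. if i \<in> insert x Y then f (insert x Y) else 0)"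
    using assms(1) by (subst sum.inter_filter) auto
  ultimately show ?thesis by simp
qed

text \<open>Up to a factor this is \<open>\<integral> \<Prod> ((1 - u) ^ r - (- u) ^ r) du\<close> over \<open>[0, 1]\<close>, the product ranging over the
  cycle lengths \<open>r\<close> of \<open>\<sigma>\<close>: expand the product over the set \<open>Y\<close> of elements lying on the cycles that
  contribute \<open>- (- u) ^ r\<close>, and integrate.\<close>

definition signed_invariant_sum :: "'a set \<Rightarrow> ('a \<Rightarrow> 'a) \<Rightarrow> real"
  where "signed_invariant_sum A \<sigma> = (\<Sum>Y\<in>invariant_sets A \<sigma>.
    of_int (sign_on Y \<sigma>) * fact (card Y) * fact (card A - card Y))"

lemma sign_on_insert_transpose:
  assumes "finite A" "p permutes A" "x \<notin> A" "Y \<subseteq> A" "p ` Y = Y" "i \<in> insert x Y"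
  shows "sign_on (insert x Y) (transp x i \<circ> p) = (if i = x then 1 else - 1) * sign_on Y p"
proof -
  have x: "p x = x" using assms permutes_not_in by metis
  then have "p ` insert x Y = insert x Y" using assms by simp
  then have "bij_betw p (insert x Y) (insert x Y)"
    using bij_betw_invariant[OF assms(2)] by blast
  then show ?thesis
    using assms finite_subset[OF assms(4,1)] sign_on_transpose_comp[of "insert x Y" p x i]
    by (auto simp: sign_on_fixpoint[of p x, OF x])
qed

lemma sign_on_transpose_fixed:
  assumes "p ` Y = Y" "x \<notin> Y" "i \<notin> Y"
  shows "sign_on Y (transp x i \<circ> p) = sign_on Y p"
proof (rule sign_on_cong[OF refl])
  fix z assume "z \<in> Y"
  then have "p z \<in> Y" using assms(1) by blast
  then have "p z \<noteq> x" "p z \<noteq> i" using assms by auto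
  then show "(transp x i \<circ> p) z = p z" by simp
qed

lemma signed_invariant_sum_insert:
  assumes "finite A" "x \<notin> A" "p permutes A" "i \<in> insert x A"
  shows "signed_invariant_sum (insert x A) (transp x i \<circ> p) =
    (\<Sum>Y\<in>invariant_sets A p. of_int (sign_on Y p) *
      ((if i \<in> Y then 0 else fact (card Y) * fact (card A + 1 - card Y)) +
       (if i \<in> insert x Y then (if i = x then 1 else - 1) * fact (card Y + 1) * fact (card A - card Y)
        else 0)))"
proof -
  have "signed_invariant_sum (insert x A) (transp x i \<circ> p) =
    (\<Sum>Y\<in>invariant_sets A p. if i \<in> Y then 0 else
      of_int (sign_on Y (transp x i \<circ> p)) * fact (card Y) * fact (card (insert x A) - card Y)) +
    (\<Sum>Y\<in>invariant_sets A p. if i \<in> insert x Y then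
      of_int (sign_on (insert x Y) (transp x i \<circ> p)) * fact (card (insert x Y)) *
        fact (card (insert x A) - card (insert x Y)) else 0)"
    unfolding signed_invariant_sum_def by (rule sum_invariant_sets_insert[OF assms(1-3)])
  also have "\<dots> = (\<Sum>Y\<in>invariant_sets A p. of_int (sign_on Y p) *
      ((if i \<in> Y then 0 else fact (card Y) * fact (card A + 1 - card Y)) +
       (if i \<in> insert x Y then (if i = x then 1 else - 1) * fact (card Y + 1) * fact (card A - card Y)
        else 0)))"
    unfolding sum.distrib[symmetric]
  proof (rule sum.cong[OF refl])
    fix Y assume "Y \<in> invariant_sets A p"
    then have Y: "Y \<subseteq> A" "p ` Y = Y" by (auto simp: invariant_sets_def)
    then have x: "x \<notin> Y" "finite Y" using assms finite_subset by auto
    have s1: "sign_on Y (transp x i \<circ> p) = sign_on Y p" if "i \<notin> Y"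
      using sign_on_transpose_fixed[OF Y(2) x(1) that] .
    have s2: "sign_on (insert x Y) (transp x i \<circ> p) = (if i = x then 1 else - 1) * sign_on Y p"
      if "i \<in> insert x Y"
      using sign_on_insert_transpose[OF assms(1,3,2) Y that] .
    show "(if i \<in> Y then 0 else
      of_int (sign_on Y (transp x i \<circ> p)) * fact (card Y) * fact (card (insert x A) - card Y)) +
     (if i \<in> insert x Y then
      of_int (sign_on (insert x Y) (transp x i \<circ> p)) * fact (card (insert x Y)) *
        fact (card (insert x A) - card (insert x Y)) else 0) = real_of_int (sign_on Y p) *
      ((if i \<in> Y then 0 else fact (card Y) * fact (card A + 1 - card Y)) +
       (if i \<in> insert x Y then (if i = x then 1 else - 1) * fact (card Y + 1) * fact (card A - card Y)
        else 0))"
      using s1 s2 x assms(1,2) by (simp del: fact_Suc add: algebra_simps)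
  qed
  finally show ?thesis .
qed

text \<open>By counting: if \<open>i\<close> were in \<open>Y\<close>, the image would lose
  \<open>a\<close> and gain nothing, against injectivity.\<close>

lemma image_eq_insert_imp_notin:
  assumes "finite Y" "inj_on p Y" "p ` Y = insert i (Y - {a})" "a \<in> Y" "a \<noteq> i"
  shows "i \<notin> Y"
proof
  assume "i \<in> Y"
  then have "p ` Y = Y - {a}" using assms by auto
  then have "card Y = card (Y - {a})" using card_image[OF assms(2)] by simp
  moreover have "card (Y - {a}) < card Y"
    using assms by (intro psubset_card_mono) auto
  ultimately show False by simp
qed

text \<open>For \<open>a \<noteq> i\<close>, the set \<open>Y\<close> consists of cycles of
  \<open>p\<close> and one chain that starts at \<open>a\<close> and whose last element is mapped to
  \<open>i\<close>. Composing with the transposition closes the chain to a cycle. Deleting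
  \<open>a\<close> leaves the cycle that starts at \<open>p a\<close>, one element shorter, so the
  sign flips; if \<open>p a = i\<close>, the cycle was only the fixed point \<open>a\<close>. For
  \<open>a = i\<close> the chain is the cycle of \<open>p\<close> through \<open>i\<close>.\<close>

lemma sign_on_transpose_remove:
  assumes "finite Y" "p permutes A" "a \<in> Y" "p ` Y = insert i (Y - {a})"
  shows "sign_on Y (transp i a \<circ> p) =
    (if p a = i then 1 else - 1) * sign_on (Y - {a}) (transp i (p a) \<circ> p)"
proof -
  define W where "W = Y - {a}"
  have Y: "Y = insert a W" "a \<notin> W" using assms(3) by (auto simp: W_def)
  have inj: "p u = p v \<longleftrightarrow> u = v" for u v
    using permutes_inj[OF assms(2)] by (simp add: inj_eq)
  have injon: "inj_on p Z" for Z
    using permutes_inj_on[OF assms(2)] .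
  have iW: "i \<notin> W"
    using image_eq_insert_imp_notin[OF assms(1) injon assms(4,3)] by (auto simp: W_def)
  have pW: "p ` W = insert i W - {p a}"
  proof -
    have "p ` W = p ` Y - {p a}"
      unfolding Y(1) using Y(2) inj by auto
    then show ?thesis using assms(4) by (simp add: W_def)
  qed
  have pa: "p a \<in> insert i W"
    using assms(3,4) by (auto simp: W_def)
  show ?thesis
  proof (cases "p a = i")
    case True
    have "p z \<noteq> a" "p z \<noteq> i" if "z \<in> W" for z
      using that pW True Y(2) iW inj[of z a] by auto
    then have "restrict_id (transp i a \<circ> p) Y = restrict_id (transp i (p a) \<circ> p) W"
      using True Y by (auto simp: restrict_id_def fun_eq_iff)
    with True show ?thesis
      by (simp add: sign_on_def W_def)
  next
    case False
    then have paW: "p a \<in> W" using pa by simp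
    then have ne: "p a \<noteq> a" using Y by auto
    let ?q = "restrict_id (transp i (p a) \<circ> p) W"
    have "p z = i \<or> p z \<in> W \<and> p z \<noteq> p a \<and> p z \<noteq> i \<and> p z \<noteq> a" if "z \<in> W" for z
      using that pW Y(2) iW by auto
    then have "restrict_id (transp i a \<circ> p) Y = transp a (p a) \<circ> ?q"
      using False Y ne paW by (fastforce simp: restrict_id_def fun_eq_iff Transposition.transpose_def)
    moreover have "(transp i (p a) \<circ> p) ` W = W"
      unfolding image_comp_transpose_eq_iff using pW paW iW
      by (auto simp: transpose_image_move)
    then have "bij_betw (transp i (p a) \<circ> p) W W"
      using injon by (auto simp: bij_betw_def intro!: comp_inj_on)
    then have "permutation ?q"
      using assms(1) Y by (intro permutes_imp_permutation[OF _ permutes_restrict_id]) auto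
    ultimately show ?thesis
      using False ne sign_compose[OF permutation_swap_id[of a "p a"], of ?q]
      by (simp add: sign_on_def W_def sign_swap_id)
  qed
qed

section \<open>Summing over the permutations \<open>(i a) p\<close> for a fixed point
  \<open>i\<close>\<close>

locale marked_permutation =
  fixes A :: "'a set" and p :: "'a \<Rightarrow> 'a" and i :: 'a
  assumes finite_A: "finite A" and perm: "p permutes A" and i_in: "i \<in> A"
begin

abbreviation n :: nat where "n \<equiv> card A"

abbreviation \<tau> :: "'a \<Rightarrow> 'a \<Rightarrow> 'a" where "\<tau> a \<equiv> transp i a \<circ> p"

text \<open>A set containing both or neither of \<open>i\<close> and \<open>a\<close> is invariant
  under \<open>\<tau> a\<close> exactly if it is invariant under \<open>p\<close>. The sets that
  separate the two points are the new ones; here \<open>a\<close> is inside, in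
  \<open>mixed'\<close> it is \<open>i\<close>.\<close>

definition mixed :: "('a set \<times> 'a) set"
  where "mixed = {(Y, a). Y \<subseteq> A \<and> i \<notin> Y \<and> a \<in> Y \<and> \<tau> a ` Y = Y}"

abbreviation invs_in :: "'a set set" where "invs_in \<equiv> {Y \<in> invariant_sets A p. i \<in> Y}"
abbreviation invs_out :: "'a set set" where "invs_out \<equiv> {Y \<in> invariant_sets A p. i \<notin> Y}"

lemma finite_subset_A: "Y \<subseteq> A \<Longrightarrow> finite Y"
  using finite_A finite_subset by blast

lemma p_inj: "p u = p v \<longleftrightarrow> u = v"
  using permutes_inj[OF perm] by (simp add: inj_eq)

lemma p_inj_on: "inj_on p Z"
  using permutes_inj_on[OF perm] .

lemma p_in: "p a \<in> A \<longleftrightarrow> a \<in> A"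
  using permutes_in_image[OF perm] .

lemma \<tau>_permutes: "a \<in> A \<Longrightarrow> \<tau> a permutes A"
  using permutes_compose[OF perm permutes_swap_id[OF i_in]] .

lemma \<tau>_invariant_iff:
  assumes "i \<notin> Y" "a \<in> Y"
  shows "\<tau> a ` Y = Y \<longleftrightarrow> p ` Y = insert i (Y - {a})"
  unfolding image_comp_transpose_eq_iff using assms
  by (simp add: transpose_image_move)

text \<open>Cycles of \<open>p\<close> with one chain that starts at \<open>a\<close> and is
  continued by \<open>i\<close> outside of \<open>Y\<close>. For \<open>a = i\<close> the chain
  closes up to the cycle through \<open>i\<close>.\<close>

definition heads :: "('a set \<times> 'a) set"
  where "heads = {(Y, a). Y \<subseteq> A \<and> a \<in> Y \<and> p ` Y = insert i (Y - {a})}"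

text \<open>What remains once the first element of the chain is gone: \<open>c\<close> is the new
  first element, or \<open>i\<close> if the chain is used up.\<close>

definition tails :: "('a set \<times> 'a) set"
  where "tails = {(W, c). W \<subseteq> A \<and> i \<notin> W \<and> c \<in> insert i W \<and> p ` W = insert i W - {c}}"

text \<open>The pairs with second component \<open>i\<close> are the boundary of the telescope:
  invariant sets of \<open>p\<close> containing \<open>i\<close> here, and those avoiding
  \<open>i\<close> for \<open>tails\<close>.\<close>

lemma heads_eq: "heads = mixed \<union> (\<lambda>Y. (Y, i)) ` invs_in"
proof (intro set_eqI, clarify)
  fix Y a
  show "(Y, a) \<in> heads \<longleftrightarrow> (Y, a) \<in> mixed \<union> (\<lambda>Y. (Y, i)) ` invs_in"
  proof (cases "a = i")
    case True
    then show ?thesis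
      by (auto simp: heads_def mixed_def invariant_sets_def insert_absorb)
  next
    case False
    then have "(Y, a) \<in> heads \<longleftrightarrow> Y \<subseteq> A \<and> i \<notin> Y \<and> a \<in> Y \<and> p ` Y = insert i (Y - {a})"
      using image_eq_insert_imp_notin[OF finite_subset_A p_inj_on] by (auto simp: heads_def)
    also have "\<dots> \<longleftrightarrow> (Y, a) \<in> mixed"
      using \<tau>_invariant_iff[of Y a] by (simp only: mixed_def mem_Collect_eq prod.case) blast
    finally show ?thesis using False by auto
  qed
qed

lemma tails_eq: "tails = mixed \<union> (\<lambda>Y. (Y, i)) ` invs_out"
proof (intro set_eqI, clarify)
  fix Y a
  show "(Y, a) \<in> tails \<longleftrightarrow> (Y, a) \<in> mixed \<union> (\<lambda>Y. (Y, i)) ` invs_out"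
  proof (cases "a = i")
    case True
    then show ?thesis
      by (auto simp: tails_def mixed_def invariant_sets_def)
  next
    case False
    then have "(Y, a) \<in> tails \<longleftrightarrow> Y \<subseteq> A \<and> i \<notin> Y \<and> a \<in> Y \<and> p ` Y = insert i (Y - {a})"
      by (auto simp: tails_def insert_Diff_if)
    also have "\<dots> \<longleftrightarrow> (Y, a) \<in> mixed"
      using \<tau>_invariant_iff[of Y a] by (simp only: mixed_def mem_Collect_eq prod.case) blast
    finally show ?thesis using False by auto
  qed
qed

lemma finite_mixed: "finite mixed"
  by (rule finite_subset[of _ "Pow A \<times> A"]) (auto simp: mixed_def finite_A)

text \<open>The removed element is recovered as the preimage under \<open>p\<close> of the new first
  element.\<close>

lemma bij_betw_heads_tails: "bij_betw (\<lambda>(Y, a). (Y - {a}, p a)) heads tails"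
proof (rule bij_betw_byWitness[where f' = "\<lambda>(W, c). (insert (inv p c) W, inv p c)"])
  have pinv: "p (inv p c) = c" "inv p (p c) = c" for c
    using permutes_inverses[OF perm] by auto
  show "\<forall>Ya\<in>heads. (\<lambda>(W, c). (insert (inv p c) W, inv p c)) ((\<lambda>(Y, a). (Y - {a}, p a)) Ya) = Ya"
    by (auto simp: heads_def pinv)
  have notin: "inv p c \<notin> W" if "(W, c) \<in> tails" for W c
    using that pinv(1) by (auto simp: tails_def)
  then show "\<forall>Wc\<in>tails. (\<lambda>(Y, a). (Y - {a}, p a)) ((\<lambda>(W, c). (insert (inv p c) W, inv p c)) Wc) = Wc"
    using pinv by auto
  show "(\<lambda>(Y, a). (Y - {a}, p a)) ` heads \<subseteq> tails"
  proof clarify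
    fix Y a assume "(Y, a) \<in> heads"
    then have Y: "Y \<subseteq> A" "a \<in> Y" "p ` Y = insert i (Y - {a})" by (auto simp: heads_def)
    have "p a \<in> insert i (Y - {a})" using Y by blast
    moreover have "i \<notin> Y - {a}"
      using image_eq_insert_imp_notin[OF finite_subset_A p_inj_on] Y by blast
    moreover have "p ` (Y - {a}) = p ` Y - {p a}"
      using p_inj by auto
    ultimately show "(Y - {a}, p a) \<in> tails"
      using Y by (auto simp: tails_def)
  qed
  show "(\<lambda>(W, c). (insert (inv p c) W, inv p c)) ` tails \<subseteq> heads"
  proof clarify
    fix W c assume Wc: "(W, c) \<in> tails"
    then have W: "W \<subseteq> A" "i \<notin> W" "c \<in> insert i W" "p ` W = insert i W - {c}"
      by (auto simp: tails_def)
    have "c \<in> A" using W i_in by auto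
    then have "inv p c \<in> A" using p_in[of "inv p c"] pinv by simp
    moreover have "insert (inv p c) W - {inv p c} = W"
      using notin[OF Wc] by auto
    moreover have "p ` insert (inv p c) W = insert i W"
      using W by (auto simp: pinv)
    ultimately show "(insert (inv p c) W, inv p c) \<in> heads"
      using W by (auto simp: heads_def)
  qed
qed

definition wt :: "nat \<Rightarrow> real" where "wt k = fact k * fact (n - k)"
definition wt' :: "nat \<Rightarrow> real" where "wt' k = fact k * fact (n + 1 - k)"

text \<open>Integrated form of \<open>(1 - u) + u = 1\<close>: up to the factor, a weight for
  \<open>n\<close> elements is the sum of two neighbouring weights for \<open>n + 1\<close>.\<close>

lemma wt'_Suc: "k \<le> n \<Longrightarrow> wt' k + wt' (k + 1) = real (n + 2) * wt k"
  by (simp add: wt_def wt'_def Suc_diff_le algebra_simps of_nat_diff)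

text \<open>Removing \<open>a\<close> from \<open>Y\<close> maps \<open>heads\<close> onto \<open>tails\<close> and flips the sign unless \<open>p a = i\<close>;
  the common part \<open>mixed\<close> of the two index sets then telescopes.\<close>

lemma mixed_telescope:
  "real (n + 2) * (\<Sum>(Y, a)\<in>mixed. of_int (sign_on Y (\<tau> a)) * wt (card Y)) =
   (\<Sum>Y\<in>invs_out. of_int (sign_on Y p) * wt' (card Y + 1)) -
   (\<Sum>Y\<in>invs_in. of_int (sign_on Y p) * wt' (card Y))"
proof -
  define F where "F = (\<lambda>(Y, a). real_of_int (sign_on Y (\<tau> a)) * wt' (card Y))"
  define G where "G = (\<lambda>(Y, a). (if a = i then 1 else - 1) *
    (real_of_int (sign_on Y (\<tau> a)) * wt' (card Y + 1)))"
  have "sum F heads = (\<Sum>Ya\<in>heads. G ((\<lambda>(Y, a). (Y - {a}, p a)) Ya))"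
  proof (rule sum.cong[OF refl], clarify)
    fix Y a assume "(Y, a) \<in> heads"
    then have Y: "Y \<subseteq> A" "a \<in> Y" "p ` Y = insert i (Y - {a})" by (auto simp: heads_def)
    have "card Y = card (Y - {a}) + 1"
      using Y finite_subset_A[OF Y(1)] by (metis card_Suc_Diff1 Suc_eq_plus1)
    then show "F (Y, a) = G (Y - {a}, p a)"
      using sign_on_transpose_remove[OF finite_subset_A[OF Y(1)] perm Y(2,3)]
      by (simp add: F_def G_def)
  qed
  also have "\<dots> = sum G tails"
    by (rule sum.reindex_bij_betw[OF bij_betw_heads_tails])
  finally have eq: "sum F heads = sum G tails" .
  have fin: "finite invs_in" "finite invs_out"
    using finite_A by auto
  have inj: "inj_on (\<lambda>Y. (Y, i)) Z" for Z :: "'a set set"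
    by (simp add: inj_on_def)
  have disj: "mixed \<inter> (\<lambda>Y. (Y, i)) ` invs_in = {}" "mixed \<inter> (\<lambda>Y. (Y, i)) ` invs_out = {}"
    by (auto simp: mixed_def)
  have "sum F heads = sum F mixed + (\<Sum>Y\<in>invs_in. F (Y, i))"
    unfolding heads_eq
    using disj fin finite_mixed by (simp add: sum.union_disjoint sum.reindex inj)
  moreover have "sum G tails = sum G mixed + (\<Sum>Y\<in>invs_out. G (Y, i))"
    unfolding tails_eq
    using disj fin finite_mixed by (simp add: sum.union_disjoint sum.reindex inj)
  moreover have "(\<Sum>Y\<in>invs_in. F (Y, i)) = (\<Sum>Y\<in>invs_in. of_int (sign_on Y p) * wt' (card Y))"
    by (simp add: F_def)
  moreover have "(\<Sum>Y\<in>invs_out. G (Y, i)) =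
      (\<Sum>Y\<in>invs_out. of_int (sign_on Y p) * wt' (card Y + 1))"
    by (simp add: G_def)
  \<comment> \<open>On \<open>mixed\<close> one has \<open>a \<noteq> i\<close>, so \<open>G\<close>
    carries a minus sign and the difference adds two neighbouring weights.\<close>
  moreover have "sum F mixed - sum G mixed =
      real (n + 2) * (\<Sum>(Y, a)\<in>mixed. of_int (sign_on Y (\<tau> a)) * wt (card Y))"
    unfolding sum_subtractf[symmetric] sum_distrib_left
  proof (rule sum.cong[OF refl], clarify)
    fix Y a assume "(Y, a) \<in> mixed"
    then have "Y \<subseteq> A" "a \<noteq> i" by (auto simp: mixed_def)
    then have "F (Y, a) - G (Y, a) =
        of_int (sign_on Y (\<tau> a)) * (wt' (card Y) + wt' (card Y + 1))"
      by (simp add: F_def G_def algebra_simps)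
    also have "wt' (card Y) + wt' (card Y + 1) = real (n + 2) * wt (card Y)"
      using \<open>Y \<subseteq> A\<close> finite_A by (intro wt'_Suc card_mono)
    finally show "F (Y, a) - G (Y, a) =
        real (n + 2) * (of_int (sign_on Y (\<tau> a)) * wt (card Y))"
      by (simp add: algebra_simps)
  qed
  ultimately show ?thesis using eq by simp
qed

lemma bij_betw_complement_invs: "bij_betw (\<lambda>Y. A - Y) invs_out invs_in"
  by (rule bij_betw_byWitness[where f' = "\<lambda>Y. A - Y"])
    (use i_in invariant_complement[OF perm] in \<open>auto simp: invariant_sets_def double_diff\<close>)

text \<open>Complementation in \<open>A\<close> exchanges the two families at the cost of the sign
  of \<open>p\<close>. The shift by one appears because \<open>wt'\<close> is symmetric about half
  of \<open>n + 1\<close> while complements add up to \<open>n\<close>.\<close>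

lemma invs_swap:
  "(\<Sum>Y\<in>invs_in. of_int (sign_on Y p) * wt' (card Y)) =
   real_of_int (sign p) * (\<Sum>Y\<in>invs_out. of_int (sign_on Y p) * wt' (card Y + 1))"
proof -
  have "(\<Sum>Y\<in>invs_in. of_int (sign_on Y p) * wt' (card Y)) =
     (\<Sum>Y\<in>invs_out. of_int (sign_on (A - Y) p) * wt' (card (A - Y)))"
    by (rule sum.reindex_bij_betw[OF bij_betw_complement_invs, symmetric])
  also have "\<dots> = (\<Sum>Y\<in>invs_out. real_of_int (sign p) * (of_int (sign_on Y p) * wt' (card Y + 1)))"
  proof (rule sum.cong[OF refl])
    fix Y assume "Y \<in> invs_out"
    then have Y: "Y \<subseteq> A" "p ` Y = Y" by (auto simp: invariant_sets_def)
    have "wt' (card (A - Y)) = wt' (card Y + 1)"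
      using Y finite_A card_mono[OF finite_A Y(1)] finite_subset_A[OF Y(1)]
      by (simp add: wt'_def card_Diff_subset)
    then show "of_int (sign_on (A - Y) p) * wt' (card (A - Y)) =
      real_of_int (sign p) * (of_int (sign_on Y p) * wt' (card Y + 1))"
      using sign_on_complement[OF finite_A perm Y] by simp
  qed
  finally show ?thesis by (simp add: sum_distrib_left)
qed

definition mixed' :: "('a set \<times> 'a) set"
  where "mixed' = {(Y, a). Y \<subseteq> A \<and> a \<in> A \<and> i \<in> Y \<and> a \<notin> Y \<and> \<tau> a ` Y = Y}"

text \<open>Again by complements; the additional minus sign arises because \<open>\<tau> a\<close>
  with \<open>a \<noteq> i\<close> has the sign opposite to that of \<open>p\<close>.\<close>

lemma sum_mixed':
  "(\<Sum>(Y, a)\<in>mixed'. of_int (sign_on Y (\<tau> a)) * wt (card Y)) =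
   - real_of_int (sign p) * (\<Sum>(Y, a)\<in>mixed. of_int (sign_on Y (\<tau> a)) * wt (card Y))"
proof -
  have "bij_betw (\<lambda>(Y, a). (A - Y, a)) mixed mixed'"
    by (rule bij_betw_byWitness[where f' = "\<lambda>(Y, a). (A - Y, a)"])
      (use i_in invariant_complement[OF \<tau>_permutes] in
        \<open>auto simp: mixed_def mixed'_def double_diff simp del: image_comp comp_apply\<close>)
  then have "(\<Sum>(Y, a)\<in>mixed'. of_int (sign_on Y (\<tau> a)) * wt (card Y)) =
     (\<Sum>Ya\<in>mixed. (\<lambda>(Y, a). real_of_int (sign_on Y (\<tau> a)) * wt (card Y)) ((\<lambda>(Y, a). (A - Y, a)) Ya))"
    by (rule sum.reindex_bij_betw[symmetric])
  also have "\<dots> = (\<Sum>(Y, a)\<in>mixed. - real_of_int (sign p) * (of_int (sign_on Y (\<tau> a)) * wt (card Y)))"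
  proof (rule sum.cong[OF refl])
    fix Ya assume "Ya \<in> mixed"
    then obtain Y a where Ya: "Ya = (Y, a)"
      and Y: "Y \<subseteq> A" "a \<in> A" "\<tau> a ` Y = Y" "a \<noteq> i" by (auto simp: mixed_def)
    have "wt (card (A - Y)) = wt (card Y)"
      using Y finite_A card_mono[OF finite_A Y(1)] finite_subset_A[OF Y(1)]
      by (simp add: wt_def card_Diff_subset)
    moreover have "sign (\<tau> a) = - sign p"
      using sign_compose[OF permutation_swap_id permutes_imp_permutation[OF finite_A perm], of i a] Y(4)
      by (simp add: sign_swap_id)
    moreover have "sign_on (A - Y) (\<tau> a) = sign (\<tau> a) * sign_on Y (\<tau> a)"
      by (rule sign_on_complement[OF finite_A \<tau>_permutes[OF Y(2)] Y(1,3)])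
    ultimately show "(case case Ya of (Y, a) \<Rightarrow> (A - Y, a) of (Y, a) \<Rightarrow> real_of_int (sign_on Y (\<tau> a)) * wt (card Y)) =
      (case Ya of (Y, a) \<Rightarrow> - real_of_int (sign p) * (of_int (sign_on Y (\<tau> a)) * wt (card Y)))"
      by (simp only: Ya prod.case) simp
  qed
  finally show ?thesis
    by (simp only: case_prod_unfold sum_distrib_left)
qed

text \<open>The invariant sets of all \<open>\<tau> a\<close> fall into four classes by which of
  \<open>i\<close> and \<open>a\<close> they contain. With both or neither, they are invariant sets
  of \<open>p\<close>, and counting the possible \<open>a\<close> gives a factor linear in the
  cardinality. The two separating classes contribute the same boundary term. The outcome is a
  multiple of the sum for the set enlarged by one point.\<close>

lemma sum_signed_invariant_sum:
  "real (n + 2) * (\<Sum>a\<in>A - {i}. signed_invariant_sum A (\<tau> a)) =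
   real n * (\<Sum>Y\<in>invariant_sets A p. of_int (sign_on Y p) *
     (if i \<in> Y then - (fact (card Y + 1) * fact (n - card Y)) else wt' (card Y)))"
proof -
  define H where "H = (\<lambda>(Y, a). real_of_int (sign_on Y (\<tau> a)) * wt (card Y))"
  define s where "s Y = real_of_int (sign_on Y p)" for Y
  define both where "both = {(Y, a). Y \<in> invs_in \<and> a \<in> Y - {i}}"
  define none where "none = {(Y, a). Y \<in> invs_out \<and> a \<in> A - Y - {i}}"
  have fin: "finite mixed'" "finite both" "finite none"
    by (rule finite_subset[of _ "Pow A \<times> A"],
        auto simp: finite_A mixed'_def both_def none_def invariant_sets_def)+
  have fin': "finite invs_in" "finite invs_out"
    using finite_A by auto
  note fin = finite_mixed fin fin'
  have disj: "(mixed \<union> mixed' \<union> both) \<inter> none = {}" "(mixed \<union> mixed') \<inter> both = {}"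
    "mixed \<inter> mixed' = {}"
    by (auto simp: mixed_def mixed'_def both_def none_def)
  have both_inv: "\<tau> a ` Y = Y \<longleftrightarrow> p ` Y = Y" if "a \<in> Y \<longleftrightarrow> i \<in> Y" for a Y
    unfolding image_comp_transpose_eq_iff using that by simp
  define E where "E = mixed \<union> mixed' \<union> both \<union> none"
  have E_iff: "(Y, a) \<in> E \<longleftrightarrow>
      a \<in> A - {i} \<and> Y \<in> invariant_sets A (\<tau> a)" for Y a
    using both_inv[of a Y] i_in
    by (simp only: E_def mixed_def mixed'_def both_def none_def invariant_sets_def mem_Collect_eq prod.case
        Un_iff Diff_iff) blast
  have "(\<Sum>a\<in>A - {i}. signed_invariant_sum A (\<tau> a)) =
      (\<Sum>a\<in>A - {i}. \<Sum>Y\<in>invariant_sets A (\<tau> a). H (Y, a))"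
    by (simp add: signed_invariant_sum_def H_def wt_def mult.assoc)
  also have "\<dots> = (\<Sum>(a, Y)\<in>(SIGMA a:A - {i}. invariant_sets A (\<tau> a)). H (Y, a))"
    using finite_A by (simp add: sum.Sigma)
  also have "\<dots> = sum H E"
    by (rule sum.reindex_bij_witness[of _ "\<lambda>(Y, a). (a, Y)" "\<lambda>(a, Y). (Y, a)"])
      (auto simp: E_iff)
  also have "\<dots> = sum H mixed + sum H mixed' + sum H both + sum H none"
    unfolding E_def using fin disj by (simp add: sum.union_disjoint)
  finally have total: "(\<Sum>a\<in>A - {i}. signed_invariant_sum A (\<tau> a)) =
    sum H mixed + sum H mixed' + sum H both + sum H none" .
  have "both = (SIGMA Y:invs_in. Y - {i})"
    by (auto simp: both_def)
  then have "sum H both = (\<Sum>Y\<in>invs_in. \<Sum>a\<in>Y - {i}. H (Y, a))"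
    using fin by (simp add: sum.Sigma finite_subset_A invariant_sets_def case_prod_unfold)
  also have "\<dots> = (\<Sum>Y\<in>invs_in. s Y * (- (real (card Y) - 1) * wt (card Y)))"
  proof (rule sum.cong[OF refl])
    fix Y assume "Y \<in> invs_in"
    then have Y: "Y \<subseteq> A" "p ` Y = Y" "i \<in> Y" by (auto simp: invariant_sets_def)
    have "H (Y, a) = - s Y * wt (card Y)" if "a \<in> Y - {i}" for a
      using that sign_on_transpose_comp[OF finite_subset_A[OF Y(1)] bij_betw_invariant[OF perm Y(2)] Y(3), of a]
      by (auto simp: H_def s_def)
    then have "(\<Sum>a\<in>Y - {i}. H (Y, a)) = real (card (Y - {i})) * (- s Y * wt (card Y))"
      by simp
    moreover have "real (card (Y - {i})) = real (card Y) - 1"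
      using Y finite_subset_A[OF Y(1)] by (metis card_Suc_Diff1 of_nat_Suc add_diff_cancel_left')
    ultimately show "(\<Sum>a\<in>Y - {i}. H (Y, a)) = s Y * (- (real (card Y) - 1) * wt (card Y))"
      by (simp add: algebra_simps)
  qed
  finally have both: "sum H both = (\<Sum>Y\<in>invs_in. s Y * (- (real (card Y) - 1) * wt (card Y)))" .
  have "none = (SIGMA Y:invs_out. A - Y - {i})"
    by (auto simp: none_def)
  then have "sum H none = (\<Sum>Y\<in>invs_out. \<Sum>a\<in>A - Y - {i}. H (Y, a))"
    using fin finite_A by (simp add: sum.Sigma case_prod_unfold)
  also have "\<dots> = (\<Sum>Y\<in>invs_out. s Y * ((real n - real (card Y) - 1) * wt (card Y)))"
  proof (rule sum.cong[OF refl])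
    fix Y assume "Y \<in> invs_out"
    then have Y: "Y \<subseteq> A" "p ` Y = Y" "i \<notin> Y" by (auto simp: invariant_sets_def)
    have "H (Y, a) = s Y * wt (card Y)" if "a \<in> A - Y - {i}" for a
      using that sign_on_transpose_fixed[OF Y(2,3), of a] by (auto simp: H_def s_def)
    then have "(\<Sum>a\<in>A - Y - {i}. H (Y, a)) = real (card (A - Y - {i})) * (s Y * wt (card Y))"
      by simp
    moreover have "real (card (A - Y - {i})) = real (card (A - Y)) - 1"
      using Y finite_A i_in card_Suc_Diff1[of "A - Y" i] by auto
    moreover have "real (card (A - Y)) = real n - real (card Y)"
      using Y(1) finite_A finite_subset_A card_mono[OF finite_A Y(1)]
      by (simp add: card_Diff_subset of_nat_diff)
    ultimately show "(\<Sum>a\<in>A - Y - {i}. H (Y, a)) = s Y * ((real n - real (card Y) - 1) * wt (card Y))"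
      by simp
  qed
  finally have none: "sum H none = (\<Sum>Y\<in>invs_out. s Y * ((real n - real (card Y) - 1) * wt (card Y)))" .
  define R0 where "R0 = (\<Sum>Y\<in>invs_out. s Y * wt' (card Y + 1))"
  define R1 where "R1 = (\<Sum>Y\<in>invs_in. s Y * wt' (card Y))"
  have tele: "real (n + 2) * sum H mixed = R0 - R1"
    using mixed_telescope by (simp add: H_def R0_def R1_def s_def case_prod_unfold)
  have "R1 = real_of_int (sign p) * R0"
    using invs_swap by (simp add: R0_def R1_def s_def)
  then have "real_of_int (sign p) * R1 = R0"
    by (metis mult.assoc mult_1 of_int_1 of_int_mult sign_idempotent)
  \<comment> \<open>For even \<open>p\<close> the difference vanishes; for odd \<open>p\<close> the
    factor is one.\<close>
  then have "- real_of_int (sign p) * (R0 - R1) = R0 - R1"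
    using \<open>R1 = real_of_int (sign p) * R0\<close> by (simp add: algebra_simps)
  moreover have "sum H mixed' = - real_of_int (sign p) * sum H mixed"
    using sum_mixed' by (simp add: H_def)
  ultimately have tele': "real (n + 2) * sum H mixed' = R0 - R1"
    using tele by (metis mult.left_commute)
  have "real (n + 2) * (\<Sum>a\<in>A - {i}. signed_invariant_sum A (\<tau> a)) =
     (\<Sum>Y\<in>invs_out. s Y * (2 * wt' (card Y + 1) + real (n + 2) * (real n - real (card Y) - 1) * wt (card Y))) +
     (\<Sum>Y\<in>invs_in. s Y * (- 2 * wt' (card Y) - real (n + 2) * (real (card Y) - 1) * wt (card Y)))"
    unfolding total distrib_left tele tele' both none R0_def R1_def
    by (simp add: sum_distrib_left sum.distrib sum_subtractf sum_negf algebra_simps)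
  \<comment> \<open>With \<open>k = card Y\<close> and after division by \<open>wt k\<close>, the
    two identities read \<open>2 (k + 1) + (n + 2) (n - k - 1) = n (n + 1 - k)\<close> and
    \<open>2 (n + 1 - k) + (n + 2) (k - 1) = n (k + 1)\<close>.\<close>
  also have "\<dots> = (\<Sum>Y\<in>invs_out. s Y * (real n * wt' (card Y))) +
     (\<Sum>Y\<in>invs_in. s Y * (- real n * (fact (card Y + 1) * fact (n - card Y))))"
  proof (intro arg_cong2[where f = "(+)"] sum.cong refl arg_cong2[where f = "(*)"])
    fix Y assume "Y \<in> invs_out"
    then have "card Y \<le> n" using finite_A card_mono by (auto simp: invariant_sets_def)
    then show "2 * wt' (card Y + 1) + real (n + 2) * (real n - real (card Y) - 1) * wt (card Y) =
        real n * wt' (card Y)"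
      by (simp add: wt_def wt'_def Suc_diff_le of_nat_diff algebra_simps)
  next
    fix Y assume "Y \<in> invs_in"
    then have "card Y \<le> n" using finite_A card_mono by (auto simp: invariant_sets_def)
    then show "- 2 * wt' (card Y) - real (n + 2) * (real (card Y) - 1) * wt (card Y) =
        - real n * (fact (card Y + 1) * fact (n - card Y))"
      by (simp add: wt_def wt'_def Suc_diff_le of_nat_diff algebra_simps)
  qed
  also have "\<dots> = (\<Sum>Y\<in>invariant_sets A p. real n * (s Y *
     (if i \<in> Y then - (fact (card Y + 1) * fact (n - card Y)) else wt' (card Y))))"
    unfolding sum.inter_filter[OF finite_invariant_sets[OF finite_A]] sum.distrib[symmetric]
    by (rule sum.cong) (auto simp del: fact_Suc)
  finally show ?thesis
    by (simp add: sum_distrib_left s_def if_distrib algebra_simps del: fact_Suc cong: if_cong)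
qed

end

section \<open>The recurrence for a fixed and for a moved point, and the induction\<close>

lemma cycle_pairs_insert_fixed:
  assumes "finite A" "A \<noteq> {}" "x \<notin> A" "\<sigma> permutes A"
  shows "cycle_pairs (insert x A) \<sigma> = card A * cycle_pairs A \<sigma>"
proof -
  have "\<sigma> x = x" using assms permutes_not_in by metis
  have "cycle_pairs A (transp x b \<circ> (transp x a \<circ> \<sigma>)) = (if b = a then cycle_pairs A \<sigma> else 0)"
    if "a \<in> A" "b \<in> A" for a b
  proof (cases "b = a")
    case True
    then show ?thesis by (simp add: o_assoc)
  next
    case False
    have "a \<noteq> x" using that assms by auto
    then have "(transp x b \<circ> (transp x a \<circ> \<sigma>)) x \<noteq> x"
      using False \<open>\<sigma> x = x\<close> by simp
    then have "\<not> (transp x b \<circ> (transp x a \<circ> \<sigma>)) permutes A"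
      using assms(3) permutes_not_in by metis
    then have "cycle_pairs A (transp x b \<circ> (transp x a \<circ> \<sigma>)) = 0"
      by (rule cycle_pairs_not_permutes)
    with False show ?thesis by simp
  qed
  then have "cycle_pairs (insert x A) \<sigma> = (\<Sum>a\<in>A. \<Sum>b\<in>A. if b = a then cycle_pairs A \<sigma> else 0)"
    unfolding cycle_pairs_insert[OF assms(1-3)] by (simp cong: sum.cong)
  then show ?thesis using assms(1) by simp
qed

text \<open>A term counts only if all three transpositions together return \<open>x\<close> to its
  place, which forces \<open>b = i\<close> and \<open>a \<noteq> i\<close>; then
  \<open>(x i) (x a) (x i)\<close> is the conjugate \<open>(i a)\<close>.\<close>

lemma cycle_pairs_insert_moved:
  assumes "finite A" "A \<noteq> {}" "x \<notin> A" "i \<in> A" "p permutes A"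
  shows "cycle_pairs (insert x A) (transp x i \<circ> p) =
    (\<Sum>a\<in>A - {i}. cycle_pairs A (transp i a \<circ> p))"
proof -
  have px: "p x = x" using assms permutes_not_in by metis
  let ?\<rho> = "\<lambda>a b. transp x b \<circ> (transp x a \<circ> (transp x i \<circ> p))"
  have "cycle_pairs A (?\<rho> a b) = (if b = i then if a = i then 0 else cycle_pairs A (transp i a \<circ> p) else 0)"
    if "a \<in> A" "b \<in> A" for a b
  proof (cases "b = i \<and> a \<noteq> i")
    case True
    have "x \<noteq> a" "x \<noteq> i" using that assms by auto
    with True have "?\<rho> a b = transp i a \<circ> p"
      by (auto simp: fun_eq_iff Transposition.transpose_def)
    with True show ?thesis by simp
  next
    case False
    have "x \<noteq> a" "x \<noteq> b" "x \<noteq> i" using that assms by auto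
    then have "?\<rho> a b x \<noteq> x"
      using False px by (auto simp: Transposition.transpose_def)
    then have "\<not> ?\<rho> a b permutes A"
      using assms(3) permutes_not_in by metis
    then have "cycle_pairs A (?\<rho> a b) = 0"
      by (rule cycle_pairs_not_permutes)
    with False show ?thesis by simp
  qed
  then have "cycle_pairs (insert x A) (transp x i \<circ> p) = (\<Sum>a\<in>A. \<Sum>b\<in>A.
      if b = i then if a = i then 0 else cycle_pairs A (transp i a \<circ> p) else 0)"
    unfolding cycle_pairs_insert[OF assms(1-3)] by (intro sum.cong refl) blast
  also have "\<dots> = (\<Sum>a\<in>A. if a = i then 0 else cycle_pairs A (transp i a \<circ> p))"
    using assms by simp
  also have "\<dots> = (\<Sum>a\<in>A - {i}. cycle_pairs A (transp i a \<circ> p))"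
    using assms(1) by (intro sum.mono_neutral_cong_right) auto
  finally show ?thesis .
qed

theorem cycle_pairs_eq_signed_invariant_sum:
  assumes "finite A" "A \<noteq> {}" "\<sigma> permutes A"
  shows "real (card A) * real (card A + 1) * real (cycle_pairs A \<sigma>) = signed_invariant_sum A \<sigma>"
  using assms
proof (induction arbitrary: \<sigma> rule: finite_ne_induct)
  case (singleton x)
  then have id: "\<sigma> = id"
    by (auto simp: permutes_def fun_eq_iff) metis
  have c: "cycle_pairs {x} id = 1"
    unfolding cycle_pairs_sum[OF finite.insertI[OF finite.emptyI]] full_cycles_singleton by simp
  have "invariant_sets {x} id = {{}, {x}}"
    by (auto simp: invariant_sets_def)
  then have s: "signed_invariant_sum {x} id = 2"
    unfolding signed_invariant_sum_def by simp
  show ?case unfolding id c s by simp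
next
  case (insert x A)
  let ?n = "card A"
  define p where "p = transp x (\<sigma> x) \<circ> \<sigma>"
  have p: "p permutes A"
    unfolding p_def using insert.prems by (rule permutes_insert_lemma)
  have \<sigma>: "\<sigma> = transp x (\<sigma> x) \<circ> p"
    by (simp add: p_def fun_eq_iff)
  have card_le: "card Y \<le> ?n" if "Y \<in> invariant_sets A p" for Y
    using that insert.hyps(1) card_mono by (auto simp: invariant_sets_def)
  have n: "?n > 0" using insert.hyps by (simp add: card_gt_0_iff)
  show ?case
  proof (cases "\<sigma> x = x")
    case True
    then have "\<sigma> = p" using \<sigma> by simp
    then have "signed_invariant_sum (insert x A) \<sigma> =
        (\<Sum>Y\<in>invariant_sets A p. of_int (sign_on Y p) *
          ((if x \<in> Y then 0 else fact (card Y) * fact (?n + 1 - card Y)) +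
            fact (card Y + 1) * fact (?n - card Y)))"
      using signed_invariant_sum_insert[OF insert.hyps(1,3) p, of x] by simp
    \<comment> \<open>Each \<open>Y\<close> yields two invariant sets of equal sign, without and
      with the fixed point \<open>x\<close>; their weights add up to \<open>card A + 2\<close> times
      the old one.\<close>
    also have "\<dots> = (\<Sum>Y\<in>invariant_sets A p.
        real (?n + 2) * (of_int (sign_on Y p) * fact (card Y) * fact (?n - card Y)))"
    proof (rule sum.cong[OF refl])
      fix Y assume Y: "Y \<in> invariant_sets A p"
      then have "x \<notin> Y" using insert.hyps(3) by (auto simp: invariant_sets_def)
      with card_le[OF Y] show "of_int (sign_on Y p) *
          ((if x \<in> Y then 0 else fact (card Y) * fact (?n + 1 - card Y)) +
            fact (card Y + 1) * fact (?n - card Y)) =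
          real (?n + 2) * (of_int (sign_on Y p) * fact (card Y) * fact (?n - card Y))"
        by (simp add: Suc_diff_le of_nat_diff algebra_simps)
    qed
    also have "\<dots> = real (?n + 2) * signed_invariant_sum A p"
      by (simp add: signed_invariant_sum_def sum_distrib_left)
    finally show ?thesis
      using insert.IH[OF p, symmetric] insert.hyps \<open>\<sigma> = p\<close>
        cycle_pairs_insert_fixed[OF insert.hyps(1,2,3) p]
      by (simp add: algebra_simps)
  next
    case False
    define i where "i = \<sigma> x"
    have i: "i \<in> A" "i \<noteq> x" "\<sigma> = transp x i \<circ> p"
      using False \<sigma> permutes_in_image[OF insert.prems, of x] by (auto simp: i_def)
    interpret marked_permutation A p i
      by standard (use insert.hyps p i in auto)
    have c: "real ?n * real (?n + 1) * real (cycle_pairs (insert x A) \<sigma>) =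
        (\<Sum>a\<in>A - {i}. signed_invariant_sum A (\<tau> a))"
      unfolding i(3) cycle_pairs_insert_moved[OF insert.hyps(1,2,3) i(1) p]
      unfolding of_nat_sum sum_distrib_left
      by (rule sum.cong[OF refl]) (rule insert.IH[OF \<tau>_permutes], simp)
    have s: "signed_invariant_sum (insert x A) \<sigma> =
      (\<Sum>Y\<in>invariant_sets A p. of_int (sign_on Y p) *
        (if i \<in> Y then - (fact (card Y + 1) * fact (n - card Y)) else wt' (card Y)))"
      unfolding i(3)
      using signed_invariant_sum_insert[OF insert.hyps(1,3) p, of i] i
      by (auto simp: wt'_def simp del: fact_Suc intro!: sum.cong)
    \<comment> \<open>The sum over \<open>a\<close> is known only with the factors
      \<open>n + 2\<close> and \<open>n\<close> attached; the latter is positive and is cancelled at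
      the end.\<close>
    have "real ?n * (real (?n + 1) * real (?n + 2) * real (cycle_pairs (insert x A) \<sigma>)) =
        real (?n + 2) * (real ?n * real (?n + 1) * real (cycle_pairs (insert x A) \<sigma>))"
      by (simp only: mult_ac)
    also have "\<dots> = real ?n * signed_invariant_sum (insert x A) \<sigma>"
      unfolding c s by (rule sum_signed_invariant_sum)
    finally have "real (?n + 1) * real (?n + 2) * real (cycle_pairs (insert x A) \<sigma>) =
        signed_invariant_sum (insert x A) \<sigma>"
      using n by (subst (asm) mult_cancel_left) simp
    then show ?thesis
      using insert.hyps by (simp add: add.commute)
  qed
qed

subsection \<open>Signed sums over separating permutations\<close>

text \<open>Colour \<open>0\<close> marks the elements outside all of the sets to be separated.\<close>

definition separates :: "'a set \<Rightarrow> ('a \<Rightarrow> nat) \<Rightarrow> ('a \<Rightarrow> 'a) \<Rightarrow> bool"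
  where "separates A c \<sigma> \<longleftrightarrow> (\<exists>f. \<forall>z\<in>A. f (\<sigma> z) = f z \<and> (c z \<noteq> 0 \<longrightarrow> f z = c z))"

definition separated_sum :: "'a set \<Rightarrow> ('a \<Rightarrow> nat) \<Rightarrow> 'a set \<Rightarrow> real"
  where "separated_sum A c Y = (\<Sum>\<sigma> | \<sigma> permutes A.
    if \<sigma> ` Y = Y \<and> separates A c \<sigma> then of_int (sign_on Y \<sigma>) else 0)"

text \<open>An uncoloured point may be spliced in anywhere: it inherits the value of
  \<open>f\<close> at its successor \<open>b\<close>.\<close>

lemma separates_insert_free:
  assumes "x \<notin> A" "c x = 0" "q permutes A" "b \<in> insert x A"
  shows "separates (insert x A) c (transp x b \<circ> q) \<longleftrightarrow> separates A c q"
proof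
  have qx: "q x = x" using assms permutes_not_in by metis
  have qA: "q z \<in> A" if "z \<in> A" for z using that permutes_in_image[OF assms(3)] by simp
  let ?s = "transp x b \<circ> q"
  have sx: "?s x = b" using qx by simp
  {
    assume "separates (insert x A) c ?s"
    then obtain f where f: "f (?s z) = f z" "c z \<noteq> 0 \<longrightarrow> f z = c z" if "z \<in> insert x A" for z
      unfolding separates_def by blast
    have "f (q z) = f z" if "z \<in> A" for z
    proof (cases "q z = b")
      case True
      then have "?s z = x" by simp
      then show ?thesis using f(1)[of z] f(1)[of x] sx that True by simp
    next
      case False
      have "q z \<noteq> x" using qA[OF that] assms(1) by auto
      then have "?s z = q z" using False by simp
      then show ?thesis using f(1)[of z] that by simp
    qed
    then show "separates A c q"
      unfolding separates_def using f(2) by blast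
  }
  assume "separates A c q"
  then obtain f where f: "f (q z) = f z" "c z \<noteq> 0 \<longrightarrow> f z = c z" if "z \<in> A" for z
    unfolding separates_def by blast
  define g where "g = f(x := f b)"
  have "g (?s z) = g z \<and> (c z \<noteq> 0 \<longrightarrow> g z = c z)" if "z \<in> insert x A" for z
  proof (cases "z = x")
    case True
    then show ?thesis using sx assms(2) by (simp add: g_def)
  next
    case False
    then have z: "z \<in> A" using that by simp
    have "q z \<noteq> x" using qA[OF z] assms(1) by auto
    then have "?s z = (if q z = b then x else q z)" by (simp add: Transposition.transpose_def)
    with \<open>q z \<noteq> x\<close> False f[OF z] show ?thesis by (auto simp: g_def)
  qed
  then show "separates (insert x A) c ?s"
    unfolding separates_def by blast
qed

text \<open>If every point is coloured, the colouring itself is the only candidate for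
  \<open>f\<close> on \<open>A\<close>.\<close>

lemma separates_coloured:
  assumes "\<sigma> permutes A" "\<And>z. z \<in> A \<Longrightarrow> c z \<noteq> 0"
  shows "separates A c \<sigma> \<longleftrightarrow> (\<forall>z\<in>A. c (\<sigma> z) = c z)"
proof
  assume "separates A c \<sigma>"
  then obtain f where f: "f (\<sigma> z) = f z" "f z = c z" if "z \<in> A" for z
    unfolding separates_def using assms(2) by blast
  then show "\<forall>z\<in>A. c (\<sigma> z) = c z"
    using permutes_in_image[OF assms(1)] by metis
qed (auto simp: separates_def)

lemma separates_insert_coloured:
  assumes "x \<notin> A" "\<And>z. z \<in> insert x A \<Longrightarrow> c z \<noteq> 0" "q permutes A" "b \<in> insert x A"
  shows "separates (insert x A) c (transp x b \<circ> q) \<longleftrightarrow> separates A c q \<and> c b = c x"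
proof -
  have qx: "q x = x" using assms permutes_not_in by metis
  have qA: "q z \<in> A" if "z \<in> A" for z using that permutes_in_image[OF assms(3)] by simp
  have q_ne: "q z \<noteq> x" if "z \<in> A" for z using qA[OF that] assms(1) by auto
  have "(\<forall>z\<in>insert x A. c ((transp x b \<circ> q) z) = c z) \<longleftrightarrow> c b = c x \<and> (\<forall>z\<in>A. c (q z) = c z)"
    using qx q_ne by (auto simp: Transposition.transpose_def)
  then show ?thesis
    using separates_coloured[OF permutes_insert_transpose[OF assms(3,4)], of c]
      separates_coloured[OF assms(3), of c] assms(2) by auto
qed

text \<open>\<open>P b\<close> says that \<open>b\<close> is an admissible successor of
  \<open>x\<close>. The summand 1 stands for \<open>x\<close> as a fixed point. Any other successor
  has to lie on the same side of \<open>Y\<close> as \<open>x\<close>, and inside \<open>Y\<close>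
  the transposition costs a minus sign.\<close>

lemma separated_sum_insert:
  assumes A: "finite A" "x \<notin> A" "Y \<subseteq> A"
    and sep: "\<And>b q. b \<in> insert x A \<Longrightarrow> q permutes A \<Longrightarrow>
      separates (insert x A) c (transp x b \<circ> q) \<longleftrightarrow> separates A c q \<and> P b"
    and P: "P x"
  shows "separated_sum (insert x A) c Y = (1 + real (card {b \<in> A - Y. P b})) * separated_sum A c Y"
    "separated_sum (insert x A) c (insert x Y) = (1 - real (card {b \<in> Y. P b})) * separated_sum A c Y"
proof -
  have xY: "x \<notin> Y" "finite Y" using A finite_subset by auto
  define D where "D q = (if q ` Y = Y \<and> separates A c q then real_of_int (sign_on Y q) else 0)" for q
  have U: "separated_sum A c Y = (\<Sum>q | q permutes A. D q)"
    by (simp add: separated_sum_def D_def)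
  have 1: "(if (transp x b \<circ> q) ` Y = Y \<and> separates (insert x A) c (transp x b \<circ> q)
      then real_of_int (sign_on Y (transp x b \<circ> q)) else 0) = of_bool (b \<notin> Y \<and> P b) * D q"
    if "b \<in> insert x A" "q permutes A" for b q
    using invariant_transpose_iff[OF that(2) A(2,3), of b] sep[OF that]
      sign_on_transpose_fixed[of q Y x b] xY
    by (auto simp: D_def simp del: image_comp)
  have 2: "(if (transp x b \<circ> q) ` insert x Y = insert x Y \<and> separates (insert x A) c (transp x b \<circ> q)
      then real_of_int (sign_on (insert x Y) (transp x b \<circ> q)) else 0) =
      of_bool (b \<in> insert x Y \<and> P b) * (if b = x then 1 else - 1) * D q"
    if "b \<in> insert x A" "q permutes A" for b q
    using invariant_insert_transpose_iff[OF that(2) A(2,3), of b] sep[OF that]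
      sign_on_insert_transpose[OF A(1) that(2) A(2,3), of b]
    by (auto simp: D_def simp del: image_comp image_insert)
  have "separated_sum (insert x A) c Y = (\<Sum>b\<in>insert x A. \<Sum>q | q permutes A. of_bool (b \<notin> Y \<and> P b) * D q)"
    unfolding separated_sum_def sum_over_permutations_insert[OF A(1,2)]
    by (intro sum.cong refl 1) auto
  also have "\<dots> = (\<Sum>b\<in>insert x A. of_bool (b \<notin> Y \<and> P b)) * separated_sum A c Y"
    unfolding U sum_product by simp
  also have "(\<Sum>b\<in>insert x A. of_bool (b \<notin> Y \<and> P b)) = 1 + (\<Sum>b\<in>A. of_bool (b \<notin> Y \<and> P b) :: real)"
    using A xY P by simp
  also have "(\<Sum>b\<in>A. of_bool (b \<notin> Y \<and> P b) :: real) = real (card {b \<in> A - Y. P b})"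
    using A(1) by (simp add: Int_def conj_ac)
  finally show "separated_sum (insert x A) c Y = (1 + real (card {b \<in> A - Y. P b})) * separated_sum A c Y" .
  have "separated_sum (insert x A) c (insert x Y) = (\<Sum>b\<in>insert x A. \<Sum>q | q permutes A.
      of_bool (b \<in> insert x Y \<and> P b) * (if b = x then 1 else - 1) * D q)"
    unfolding separated_sum_def sum_over_permutations_insert[OF A(1,2)]
    by (intro sum.cong refl 2) auto
  also have "\<dots> = (\<Sum>b\<in>insert x A. of_bool (b \<in> insert x Y \<and> P b) * (if b = x then 1 else - 1)) *
      separated_sum A c Y"
    unfolding U sum_product by simp
  also have "(\<Sum>b\<in>insert x A. of_bool (b \<in> insert x Y \<and> P b) * (if b = x then 1 else - 1)) =
      1 + (\<Sum>b\<in>A. of_bool (b \<in> insert x Y \<and> P b) * (if b = x then 1 else - 1) :: real)"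
    using A P by simp
  also have "(\<Sum>b\<in>A. of_bool (b \<in> insert x Y \<and> P b) * (if b = x then 1 else - 1) :: real) =
      (\<Sum>b\<in>A. - of_bool (b \<in> Y \<and> P b))"
    using A by (intro sum.cong) auto
  also have "\<dots> = - real (card {b \<in> Y. P b})"
  proof -
    have "A \<inter> {b. b \<in> Y \<and> P b} = {b \<in> Y. P b}" using A by auto
    then show ?thesis using A(1) by (simp add: sum_negf)
  qed
  finally show "separated_sum (insert x A) c (insert x Y) =
      (1 - real (card {b \<in> Y. P b})) * separated_sum A c Y"
    by simp
qed

text \<open>Every colour class is permuted by itself. Its part outside \<open>Y\<close> contributes
  the number of permutations, its part inside \<open>Y\<close> the sum of their signs, which
  vanishes from two elements on.\<close>

lemma separated_sum_coloured:
  assumes "finite A" "\<And>z. z \<in> A \<Longrightarrow> c z \<in> {1..t}" "Y \<subseteq> A"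
  shows "separated_sum A c Y = (\<Prod>j\<in>{1..t}.
    of_bool (card {z \<in> Y. c z = j} \<le> 1) * fact (card {z \<in> A - Y. c z = j}))"
  using assms
proof (induction arbitrary: Y rule: finite_induct)
  case empty
  then show ?case by (simp add: separated_sum_def separates_def sign_on_def restrict_id_def)
next
  case (insert x A)
  let ?h = "\<lambda>A Y j. of_bool (card {z \<in> Y. c z = j} \<le> 1) * fact (card {z \<in> A - Y. c z = j}) :: real"
  define i where "i = c x"
  have i: "i \<in> {1..t}" using insert.prems by (simp add: i_def)
  have nz: "c z \<noteq> 0" if "z \<in> insert x A" for z using insert.prems(1)[OF that] by simp
  define W where "W = Y - {x}"
  have W: "W \<subseteq> A" "finite W" using insert.prems insert.hyps finite_subset by (auto simp: W_def)
  have IH: "separated_sum A c W = (\<Prod>j\<in>{1..t}. ?h A W j)"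
    using insert.IH[OF _ W(1)] insert.prems by simp
  note step = separated_sum_insert[OF insert.hyps(1,2) W(1),
      of c "\<lambda>b. c b = c x", OF separates_insert_coloured[OF insert.hyps(2) nz] refl]
  have rest: "(\<Prod>j\<in>{1..t} - {i}. ?h (insert x A) Y j) = (\<Prod>j\<in>{1..t} - {i}. ?h A W j)"
  proof (rule prod.cong[OF refl])
    fix j assume "j \<in> {1..t} - {i}"
    then have "{z \<in> Y. c z = j} = {z \<in> W. c z = j}"
      "{z \<in> insert x A - Y. c z = j} = {z \<in> A - W. c z = j}"
      by (auto simp: W_def i_def)
    then show "?h (insert x A) Y j = ?h A W j" by simp
  qed
  have split: "(\<Prod>j\<in>{1..t}. ?h B Z j) = ?h B Z i * (\<Prod>j\<in>{1..t} - {i}. ?h B Z j)" for B Z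
    using i by (intro prod.remove) auto
  show ?case
  proof (cases "x \<in> Y")
    case True
    then have Y: "Y = insert x W" "x \<notin> W" by (auto simp: W_def)
    have "{z \<in> Y. c z = i} = insert x {z \<in> W. c z = i}" using Y by (auto simp: i_def)
    then have "card {z \<in> Y. c z = i} = Suc (card {z \<in> W. c z = i})" using Y W by simp
    moreover have "{z \<in> insert x A - Y. c z = i} = {z \<in> A - W. c z = i}"
      using Y insert.hyps by auto
    \<comment> \<open>The factor is one if the class had no element in \<open>W\<close> and zero if
      it had one; with more elements both sides vanish already.\<close>
    ultimately have hi: "?h (insert x A) Y i = (1 - real (card {z \<in> W. c z = i})) * ?h A W i"
      by (cases "card {z \<in> W. c z = i}") auto
    have "separated_sum (insert x A) c Y = (1 - real (card {z \<in> W. c z = i})) * separated_sum A c W"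
      using step(2) Y by (simp add: i_def)
    also have "\<dots> = (1 - real (card {z \<in> W. c z = i})) * (?h A W i * (\<Prod>j\<in>{1..t} - {i}. ?h A W j))"
      unfolding IH by (rule arg_cong[OF split])
    also have "\<dots> = ?h (insert x A) Y i * (\<Prod>j\<in>{1..t} - {i}. ?h (insert x A) Y j)"
      unfolding rest hi by (rule mult.assoc[symmetric])
    also have "\<dots> = (\<Prod>j\<in>{1..t}. ?h (insert x A) Y j)"
      by (rule split[symmetric])
    finally show ?thesis .
  next
    case False
    then have Y: "Y = W" by (simp add: W_def)
    have "{z \<in> insert x A - Y. c z = i} = insert x {z \<in> A - W. c z = i}"
      using Y False by (auto simp: i_def)
    then have "card {z \<in> insert x A - Y. c z = i} = Suc (card {z \<in> A - W. c z = i})"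
      using insert.hyps by simp
    then have hi: "?h (insert x A) Y i = (1 + real (card {z \<in> A - W. c z = i})) * ?h A W i"
      using Y by simp
    have "separated_sum (insert x A) c Y = (1 + real (card {z \<in> A - W. c z = i})) * separated_sum A c W"
      using step(1) Y by (simp add: i_def)
    also have "\<dots> = (1 + real (card {z \<in> A - W. c z = i})) * (?h A W i * (\<Prod>j\<in>{1..t} - {i}. ?h A W j))"
      unfolding IH by (rule arg_cong[OF split])
    also have "\<dots> = ?h (insert x A) Y i * (\<Prod>j\<in>{1..t} - {i}. ?h (insert x A) Y j)"
      unfolding rest hi by (rule mult.assoc[symmetric])
    also have "\<dots> = (\<Prod>j\<in>{1..t}. ?h (insert x A) Y j)"
      by (rule split[symmetric])
    finally show ?thesis .
  qed
qed

subsection \<open>Generating functions\<close>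

text \<open>The series \<open>(1 + c z) ^ r\<close>.\<close>

definition fps_powr :: "real \<Rightarrow> real \<Rightarrow> real fps"
  where "fps_powr c r = fps_compose (fps_binomial r) (fps_const c * fps_X)"

lemma fps_powr_nth: "fps_nth (fps_powr c r) k = c ^ k * (r gchoose k)"
  by (simp add: fps_powr_def fps_compose_linear fps_binomial_def)

lemma fps_powr_nth_0 [simp]: "fps_nth (fps_powr c r) 0 = 1"
  by (simp add: fps_powr_nth)

lemma fps_powr_0 [simp]: "fps_powr c 0 = 1"
proof (rule fps_ext)
  show "fps_nth (fps_powr c 0) k = fps_nth 1 k" for k
    by (cases k) (simp_all add: fps_powr_nth)
qed

lemma fps_powr_add: "fps_powr c (r + s) = fps_powr c r * fps_powr c s"
  by (simp add: fps_powr_def fps_binomial_add_mult fps_compose_mult_distrib)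

lemma fps_powr_1: "fps_powr c 1 = 1 + fps_const c * fps_X"
  by (simp add: fps_powr_def fps_binomial_1 fps_compose_add_distrib)

lemma fps_powr_sum: "fps_powr c (\<Sum>j\<in>J. r j) = (\<Prod>j\<in>J. fps_powr c (r j))"
  by (induction J rule: infinite_finite_induct) (simp_all add: fps_powr_add)

lemma fps_deriv_powr: "fps_deriv (fps_powr c r) = fps_const (c * r) * fps_powr c (r - 1)"
proof (rule fps_ext)
  fix k
  have "real (Suc k) * (r gchoose Suc k) = r * ((r - 1) gchoose k)"
    using gbinomial_absorption[of k r] by simp
  then show "fps_nth (fps_deriv (fps_powr c r)) k = fps_nth (fps_const (c * r) * fps_powr c (r - 1)) k"
    by (simp add: fps_powr_nth algebra_simps)
qed

lemma sum_Pow_insert: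
  assumes "finite A" "x \<notin> A"
  shows "sum f (Pow (insert x A)) = sum f (Pow A) + (\<Sum>Y\<in>Pow A. f (insert x Y))"
proof -
  have "inj_on (insert x) (Pow A)"
    using assms(2) by (intro inj_onI) (auto simp: insert_ident subset_iff)
  moreover have "Pow A \<inter> insert x ` Pow A = {}" using assms(2) by auto
  ultimately show ?thesis
    using assms(1) by (simp add: Pow_insert sum.union_disjoint sum.reindex)
qed

lemma sum_Pow_UN_disjoint:
  fixes g :: "'i \<Rightarrow> 'a set \<Rightarrow> 'b :: comm_semiring_1"
  assumes "finite J" "\<And>j. j \<in> J \<Longrightarrow> finite (B j)" "disjoint_family_on B J"
  shows "(\<Sum>Y\<in>Pow (\<Union>j\<in>J. B j). \<Prod>j\<in>J. g j (Y \<inter> B j)) = (\<Prod>j\<in>J. \<Sum>Y\<in>Pow (B j). g j Y)"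
  using assms
proof (induction rule: finite_induct)
  case (insert i J)
  let ?U = "\<Union>j\<in>J. B j"
  have disj: "B i \<inter> ?U = {}" "disjoint_family_on B J"
    using insert.prems(2) insert.hyps(2) by (auto simp: disjoint_family_on_def)
  have "(\<Sum>Y\<in>Pow (\<Union>j\<in>insert i J. B j). \<Prod>j\<in>insert i J. g j (Y \<inter> B j)) =
      (\<Sum>(Z, Y)\<in>Pow (B i) \<times> Pow ?U. g i Z * (\<Prod>j\<in>J. g j (Y \<inter> B j)))"
  proof (rule sum.reindex_bij_witness[of _ "\<lambda>(Z, Y). Z \<union> Y" "\<lambda>Y. (Y \<inter> B i, Y \<inter> ?U)"])
    fix Y assume Y: "Y \<in> Pow (\<Union>j\<in>insert i J. B j)"
    show "(case (Y \<inter> B i, Y \<inter> ?U) of (Z, Y) \<Rightarrow> Z \<union> Y) = Y" using Y by auto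
    show "(Y \<inter> B i, Y \<inter> ?U) \<in> Pow (B i) \<times> Pow ?U" by auto
    have "(\<Prod>j\<in>J. g j (Y \<inter> ?U \<inter> B j)) = (\<Prod>j\<in>J. g j (Y \<inter> B j))"
    proof (rule prod.cong[OF refl])
      fix j assume "j \<in> J"
      then have "Y \<inter> ?U \<inter> B j = Y \<inter> B j" by auto
      then show "g j (Y \<inter> ?U \<inter> B j) = g j (Y \<inter> B j)" by (rule arg_cong)
    qed
    then show "(case (Y \<inter> B i, Y \<inter> ?U) of (Z, Y) \<Rightarrow> g i Z * (\<Prod>j\<in>J. g j (Y \<inter> B j))) =
        (\<Prod>j\<in>insert i J. g j (Y \<inter> B j))"
      using insert.hyps by simp
  qed (use disj in auto)
  also have "\<dots> = (\<Sum>Z\<in>Pow (B i). g i Z) * (\<Sum>Y\<in>Pow ?U. \<Prod>j\<in>J. g j (Y \<inter> B j))"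
    by (simp add: sum_product sum.cartesian_product)
  finally show ?case
    using insert disj by simp
qed simp

section \<open>Weights \<open>a\<close> outside and \<open>v\<close> inside of \<open>Y\<close>,
  deformed into power series\<close>

locale fugacities =
  fixes a v :: real
  assumes sum_1: "a + v = 1"
begin

text \<open>This is \<open>\<alpha> ^ r * \<beta> ^ y\<close> with
  \<open>\<alpha> = a / (1 - a z)\<close> and \<open>\<beta> = v / (1 + v z)\<close>, the solutions
  of \<open>\<alpha>' = \<alpha> ^ 2\<close> and \<open>\<beta>' = - \<beta> ^ 2\<close> with values
  \<open>a\<close> and \<open>v\<close> at 0.\<close>

definition block :: "nat \<Rightarrow> nat \<Rightarrow> real fps"
  where "block r y = fps_const (a ^ r * v ^ y) * fps_powr (- a) (- real r) * fps_powr v (- real y)"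

definition separated_gf :: "'a set \<Rightarrow> ('a \<Rightarrow> nat) \<Rightarrow> real fps"
  where "separated_gf A c = fps_powr (- a) (- 1) * fps_powr v 1 *
    (\<Sum>Y\<in>Pow A. fps_const (separated_sum A c Y) * block (card (A - Y)) (card Y))"

text \<open>The prefactor has logarithmic derivative \<open>\<alpha> + \<beta>\<close>, the block
  has \<open>r \<alpha> - y \<beta>\<close>. The prefactor thus supplies the summand 1 that an
  insertion owes to the fixed point.\<close>

lemma fps_deriv_weighted_block:
  "fps_deriv (fps_powr (- a) (- 1) * fps_powr v 1 * block r y) =
    fps_powr (- a) (- 1) * fps_powr v 1 *
      (fps_const (1 + real r) * block (Suc r) y + fps_const (1 - real y) * block r (Suc y))"
proof -
  have eq: "fps_powr (- a) (- 1) * fps_powr v 1 * block r y =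
      fps_const (a ^ r * v ^ y) * (fps_powr (- a) (- 1 - real r) * fps_powr v (1 - real y))" for r y
    unfolding block_def diff_conv_add_uminus fps_powr_add by (simp add: mult_ac)
  have "fps_powr (- a) (- 1) * fps_powr v 1 *
      (fps_const (1 + real r) * block (Suc r) y + fps_const (1 - real y) * block r (Suc y)) =
      fps_const (1 + real r) * (fps_powr (- a) (- 1) * fps_powr v 1 * block (Suc r) y) +
      fps_const (1 - real y) * (fps_powr (- a) (- 1) * fps_powr v 1 * block r (Suc y))"
    by (simp add: algebra_simps)
  also have "\<dots> = fps_const ((1 + real r) * a ^ Suc r * v ^ y) *
        (fps_powr (- a) (- 2 - real r) * fps_powr v (1 - real y)) +
      fps_const ((1 - real y) * a ^ r * v ^ Suc y) *
        (fps_powr (- a) (- 1 - real r) * fps_powr v (- real y))"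
    unfolding eq by (simp add: mult_ac flip: fps_const_mult)
  also have "\<dots> = fps_deriv (fps_powr (- a) (- 1) * fps_powr v 1 * block r y)"
  proof -
    have e: "- 1 - real r - 1 = - 2 - real r" "1 - real y - 1 = - real y" by simp_all
    have c: "(1 + real r) * a ^ Suc r * v ^ y = a ^ r * v ^ y * (- a * (- 1 - real r))"
      "(1 - real y) * a ^ r * v ^ Suc y = a ^ r * v ^ y * (v * (1 - real y))"
      by (simp_all add: algebra_simps)
    show ?thesis
      unfolding eq fps_deriv_mult fps_deriv_powr fps_deriv_const e c fps_const_mult[symmetric]
      by (simp only: distrib_left mult_ac mult_zero_left add_0_right add_0_left add_ac mult_zero_right)
  qed
  finally show ?thesis by (rule sym)
qed

text \<open>The exponents in \<open>block\<close> are chosen such that differentiation reproduces the factors of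
  \<open>separated_sum_insert\<close>; hence the value at \<open>0\<close> for the whole set is a Taylor coefficient of the
  series for the coloured elements alone.\<close>

lemma separated_gf_insert_free:
  assumes "finite A" "x \<notin> A" "c x = 0"
  shows "separated_gf (insert x A) c = fps_deriv (separated_gf A c)"
proof -
  let ?K = "fps_powr (- a) (- 1) * fps_powr v 1"
  let ?U = "\<lambda>A Y. fps_const (separated_sum A c Y)"
  have step: "separated_sum (insert x A) c Y = (1 + real (card (A - Y))) * separated_sum A c Y"
    "separated_sum (insert x A) c (insert x Y) = (1 - real (card Y)) * separated_sum A c Y"
    if "Y \<in> Pow A" for Y
    using separated_sum_insert[OF assms(1,2), of Y c "\<lambda>_. True"] that
      separates_insert_free[of x A c] assms by (auto simp: set_diff_eq)
  have "separated_gf (insert x A) c = ?K *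
    (\<Sum>Y\<in>Pow A. ?U (insert x A) Y * block (card (insert x A - Y)) (card Y) +
      ?U (insert x A) (insert x Y) * block (card (insert x A - insert x Y)) (card (insert x Y)))"
    unfolding separated_gf_def sum_Pow_insert[OF assms(1,2)] by (simp add: sum.distrib)
  also have "\<dots> = (\<Sum>Y\<in>Pow A. ?U A Y * (?K *
      (fps_const (1 + real (card (A - Y))) * block (Suc (card (A - Y))) (card Y) +
       fps_const (1 - real (card Y)) * block (card (A - Y)) (Suc (card Y)))))"
    unfolding sum_distrib_left
  proof (rule sum.cong[OF refl])
    fix Y assume Y: "Y \<in> Pow A"
    then have fin: "finite Y" "x \<notin> Y" using assms finite_subset by auto
    have c: "card (insert x A - Y) = Suc (card (A - Y))" "card (insert x Y) = Suc (card Y)"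
      "insert x A - insert x Y = A - Y"
      using assms fin by (auto simp: insert_Diff_if)
    show "?K * (?U (insert x A) Y * block (card (insert x A - Y)) (card Y) +
      ?U (insert x A) (insert x Y) * block (card (insert x A - insert x Y)) (card (insert x Y))) =
      ?U A Y * (?K *
      (fps_const (1 + real (card (A - Y))) * block (Suc (card (A - Y))) (card Y) +
       fps_const (1 - real (card Y)) * block (card (A - Y)) (Suc (card Y))))"
      unfolding c step[OF Y] fps_const_mult[symmetric] by (simp only: distrib_left mult_ac)
  qed
  also have "\<dots> = (\<Sum>Y\<in>Pow A. ?U A Y * fps_deriv (?K * block (card (A - Y)) (card Y)))"
    unfolding fps_deriv_weighted_block ..
  also have "\<dots> = fps_deriv (\<Sum>Y\<in>Pow A. ?U A Y * (?K * block (card (A - Y)) (card Y)))"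
    by (simp add: fps_deriv_sum)
  also have "(\<Sum>Y\<in>Pow A. ?U A Y * (?K * block (card (A - Y)) (card Y))) = separated_gf A c"
    unfolding separated_gf_def sum_distrib_left by (simp add: mult_ac)
  finally show ?thesis .
qed

text \<open>Only the empty set and the singletons contribute. With \<open>s = card B\<close> they
  add up to \<open>s! \<alpha> ^ (s - 1) (\<alpha> + \<beta>)\<close>, and \<open>a + v = 1\<close>
  reduces \<open>\<alpha> + \<beta>\<close> to \<open>1 / ((1 - a z) (1 + v z))\<close>.\<close>

lemma block_sum:
  assumes "finite B" "B \<noteq> {}"
  shows "(\<Sum>Y\<in>Pow B. fps_const (of_bool (card Y \<le> 1) * fact (card (B - Y))) * block (card (B - Y)) (card Y)) =
    fps_const (fact (card B) * a ^ (card B - 1)) * fps_powr (- a) (- real (card B)) * fps_powr v (- 1)"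
proof -
  let ?g = "\<lambda>Y. fps_const (of_bool (card Y \<le> 1) * fact (card (B - Y))) * block (card (B - Y)) (card Y)"
  obtain m where m: "card B = Suc m"
    using assms by (metis card_gt_0_iff gr0_implies_Suc)
  have "sum ?g (Pow B) = sum ?g (insert {} ((\<lambda>x. {x}) ` B))"
  proof (rule sum.mono_neutral_right)
    show "\<forall>Y\<in>Pow B - insert {} ((\<lambda>x. {x}) ` B). ?g Y = 0"
    proof
      fix Y assume Y: "Y \<in> Pow B - insert {} ((\<lambda>x. {x}) ` B)"
      then have "finite Y" using assms finite_subset by auto
      moreover have "card Y \<noteq> 0" "card Y \<noteq> 1"
        using Y \<open>finite Y\<close> by (auto simp: card_1_singleton_iff)
      ultimately have "\<not> card Y \<le> 1" by linarith
      then show "?g Y = 0" by simp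
    qed
  qed (use assms in auto)
  also have "\<dots> = ?g {} + (\<Sum>x\<in>B. ?g {x})"
    using assms by (subst sum.insert) (auto simp: sum.reindex)
  also have "(\<Sum>x\<in>B. ?g {x}) = (\<Sum>x\<in>B. fps_const (fact m) * block m 1)"
    using assms m by (intro sum.cong) (auto simp: card_Diff_singleton)
  also have "\<dots> = fps_const (fact (Suc m)) * block m 1"
    by (simp only: m sum_constant fact_Suc fps_const_mult[symmetric] fps_of_nat mult.assoc)
  also have "?g {} = fps_const (fact (Suc m)) * block (Suc m) 0"
    using m by simp
  also have "fps_const (fact (Suc m)) * block (Suc m) 0 + fps_const (fact (Suc m)) * block m 1 =
      fps_const (fact (Suc m) * a ^ m) * fps_powr (- a) (- real (Suc m)) * fps_powr v (- 1) *
      (fps_const a * fps_powr v 1 + fps_const v * fps_powr (- a) 1)"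
  proof -
    let ?P = "fps_powr (- a) (- real (Suc m))" and ?Q = "fps_powr v (- 1)"
    have "fps_const (a ^ m) * ?P * ?Q * (fps_const a * fps_powr v 1) =
        fps_const (a ^ Suc m) * ?P * (fps_powr v 1 * ?Q)"
      by (simp only: power_Suc fps_const_mult[symmetric] mult_ac)
    also have "fps_powr v 1 * ?Q = 1"
      using fps_powr_add[of v 1 "- 1"] by simp
    also have "fps_const (a ^ Suc m) * ?P * 1 = block (Suc m) 0"
      by (simp add: block_def)
    finally have 1: "block (Suc m) 0 = fps_const (a ^ m) * ?P * ?Q * (fps_const a * fps_powr v 1)"
      by (rule sym)
    have "fps_const (a ^ m) * ?P * ?Q * (fps_const v * fps_powr (- a) 1) =
        fps_const (a ^ m * v) * (?P * fps_powr (- a) 1) * ?Q"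
      by (simp only: fps_const_mult[symmetric] mult_ac)
    also have "?P * fps_powr (- a) 1 = fps_powr (- a) (- real m)"
      using fps_powr_add[of "- a" "- real (Suc m)" 1] by simp
    also have "fps_const (a ^ m * v) * fps_powr (- a) (- real m) * ?Q = block m 1"
      by (simp add: block_def)
    finally have 2: "block m 1 = fps_const (a ^ m) * ?P * ?Q * (fps_const v * fps_powr (- a) 1)"
      by (rule sym)
    show ?thesis
      unfolding 1 2 fps_const_mult[symmetric] by (simp only: distrib_left mult_ac)
  qed
  also have "fps_const a * fps_powr v 1 + fps_const v * fps_powr (- a) 1 = 1"
  proof -
    have "fps_const a * fps_powr v 1 + fps_const v * fps_powr (- a) 1 = fps_const (a + v)"
      unfolding fps_powr_1 by (simp add: algebra_simps flip: fps_const_add)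
    then show ?thesis using sum_1 by simp
  qed
  finally show ?thesis using m by simp
qed

lemma block_0_0 [simp]: "block 0 0 = 1"
  by (simp add: block_def)

lemma block_add: "block (r + r') (y + y') = block r y * block r' y'"
proof -
  have "- real (r + r') = - real r + - real r'" "- real (y + y') = - real y + - real y'"
    by simp_all
  then show ?thesis
    unfolding block_def by (simp only: fps_powr_add power_add fps_const_mult[symmetric] mult_ac)
qed

lemma block_sums: "block (\<Sum>j\<in>J. r j) (\<Sum>j\<in>J. y j) = (\<Prod>j\<in>J. block (r j) (y j))"
  by (induction J rule: infinite_finite_induct) (simp_all add: block_add)

lemma fps_const_prods: "fps_const (\<Prod>j\<in>J. f j) = (\<Prod>j\<in>J. fps_const (f j :: real))"
proof (induction J rule: infinite_finite_induct)
  case (insert x F)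
  then show ?case by (simp del: fps_const_mult add: fps_const_mult[symmetric])
qed simp_all

text \<open>The sum factorises over the colour classes, each giving one factor
  \<open>1 / (1 + v z)\<close>; the prefactor in \<open>separated_gf\<close> shifts both exponents
  by one.\<close>

lemma separated_gf_coloured:
  assumes fin: "finite A" and col: "\<And>z. z \<in> A \<Longrightarrow> c z \<in> {1..t}"
    and ne: "\<And>j. j \<in> {1..t} \<Longrightarrow> {z \<in> A. c z = j} \<noteq> {}"
    and s: "\<And>j. j \<in> {1..t} \<Longrightarrow> card {z \<in> A. c z = j} = s j"
  shows "separated_gf A c = fps_const ((\<Prod>j\<in>{1..t}. fact (s j)) * a ^ ((\<Sum>j\<in>{1..t}. s j) - t)) *
    (fps_powr (- a) (- (real (\<Sum>j\<in>{1..t}. s j) + 1)) * fps_powr v (1 - real t))"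
proof -
  let ?J = "{1..t}"
  define B where "B j = {z \<in> A. c z = j}" for j
  have finB: "finite (B j)" for j using fin by (simp add: B_def)
  have disjB: "disjoint_family_on B ?J" by (auto simp: disjoint_family_on_def B_def)
  have A: "A = (\<Union>j\<in>?J. B j)" using col by (auto simp: B_def)
  define g where "g j Y = fps_const (of_bool (card Y \<le> 1) * fact (card (B j - Y))) *
    block (card (B j - Y)) (card Y)" for j Y
  have cards: "card Z = (\<Sum>j\<in>?J. card (Z \<inter> B j))" if "Z \<subseteq> A" for Z
  proof -
    have "Z = (\<Union>j\<in>?J. Z \<inter> B j)" using that A by auto
    then have "card Z = card (\<Union>j\<in>?J. Z \<inter> B j)" by simp
    also have "\<dots> = (\<Sum>j\<in>?J. card (Z \<inter> B j))"
      using finB by (intro card_UN_disjoint) (auto simp: B_def)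
    finally show ?thesis .
  qed
  have "(\<Sum>Y\<in>Pow A. fps_const (separated_sum A c Y) * block (card (A - Y)) (card Y)) =
      (\<Sum>Y\<in>Pow A. \<Prod>j\<in>?J. g j (Y \<inter> B j))"
  proof (rule sum.cong[OF refl])
    fix Y assume Y: "Y \<in> Pow A"
    have "(A - Y) \<inter> B j = B j - Y \<inter> B j" for j by (auto simp: B_def)
    then have "block (card (A - Y)) (card Y) =
        (\<Prod>j\<in>?J. block (card (B j - Y \<inter> B j)) (card (Y \<inter> B j)))"
      using Y cards[of "A - Y"] cards[of Y] block_sums by simp
    note 1 = this
    have "{z \<in> Y. c z = j} = Y \<inter> B j" "{z \<in> A - Y. c z = j} = B j - Y \<inter> B j" for j
      using Y by (auto simp: B_def)
    then have 2: "separated_sum A c Y =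
        (\<Prod>j\<in>?J. of_bool (card (Y \<inter> B j) \<le> 1) * fact (card (B j - Y \<inter> B j)))"
      using separated_sum_coloured[OF fin col, where Y = Y] Y by simp
    show "fps_const (separated_sum A c Y) * block (card (A - Y)) (card Y) =
        (\<Prod>j\<in>?J. g j (Y \<inter> B j))"
      unfolding 1 2 fps_const_prods g_def by (rule prod.distrib[symmetric])
  qed
  also have "\<dots> = (\<Prod>j\<in>?J. \<Sum>Y\<in>Pow (B j). g j Y)"
    unfolding A by (rule sum_Pow_UN_disjoint) (use finB disjB in auto)
  also have "\<dots> = (\<Prod>j\<in>?J. fps_const (fact (s j) * a ^ (s j - 1)) *
      fps_powr (- a) (- real (s j)) * fps_powr v (- 1))"
    unfolding g_def using block_sum[OF finB] ne s by (intro prod.cong) (auto simp: B_def)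
  also have "\<dots> = fps_const (\<Prod>j\<in>?J. fact (s j) * a ^ (s j - 1)) *
      fps_powr (- a) (\<Sum>j\<in>?J. - real (s j)) * fps_powr v (\<Sum>j\<in>?J. - 1)"
    unfolding fps_powr_sum fps_const_prods unfolding prod.distrib ..
  also have "(\<Prod>j\<in>?J. fact (s j) * a ^ (s j - 1)) =
      (\<Prod>j\<in>?J. fact (s j)) * a ^ (\<Sum>j\<in>?J. s j - 1)"
    by (simp add: prod.distrib power_sum)
  \<comment> \<open>The truncated subtractions are harmless because every class is nonempty.\<close>
  also have "(\<Sum>j\<in>?J. s j - 1) = (\<Sum>j\<in>?J. s j) - t"
  proof -
    have "1 \<le> s j" if "j \<in> ?J" for j
    proof -
      have "card {z \<in> A. c z = j} > 0"
        using ne[OF that] fin by (simp add: card_gt_0_iff)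
      then show ?thesis using s[OF that] by simp
    qed
    then have "(\<Sum>j\<in>?J. s j - 1) = (\<Sum>j\<in>?J. s j) - (\<Sum>j\<in>?J. 1)"
      by (intro sum_subtractf_nat) auto
    then show ?thesis by simp
  qed
  finally have eq: "(\<Sum>Y\<in>Pow A. fps_const (separated_sum A c Y) * block (card (A - Y)) (card Y)) =
    fps_const ((\<Prod>j\<in>?J. fact (s j)) * a ^ ((\<Sum>j\<in>?J. s j) - t)) *
    fps_powr (- a) (\<Sum>j\<in>?J. - real (s j)) * fps_powr v (\<Sum>j\<in>?J. - 1)" .
  have e: "- (real (\<Sum>j\<in>?J. s j) + 1) = - 1 + (\<Sum>j\<in>?J. - real (s j))"
    "1 - real t = 1 + (\<Sum>j\<in>?J. - 1)"
    by (simp_all add: sum_negf)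
  show ?thesis
    unfolding separated_gf_def eq e fps_powr_add by (simp only: mult_ac)
qed

lemma separated_gf_free:
  assumes "finite R" "finite A" "A \<inter> R = {}" "\<And>x. x \<in> R \<Longrightarrow> c x = 0"
  shows "separated_gf (A \<union> R) c = (fps_deriv ^^ card R) (separated_gf A c)"
  using assms
proof (induction rule: finite_induct)
  case (insert x R)
  then show ?case
    using separated_gf_insert_free[of "A \<union> R" x c] by simp
qed simp

lemma separated_weight:
  assumes fin: "finite A" and col: "\<And>z. z \<in> A \<Longrightarrow> c z \<le> t"
    and ne: "\<And>j. j \<in> {1..t} \<Longrightarrow> {z \<in> A. c z = j} \<noteq> {}"
    and s: "\<And>j. j \<in> {1..t} \<Longrightarrow> card {z \<in> A. c z = j} = s j"
    and l: "l = (\<Sum>j\<in>{1..t}. s j)"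
  shows "(\<Sum>Y\<in>Pow A. separated_sum A c Y * (a ^ card (A - Y) * v ^ card Y)) =
    fact (card A - l) * ((\<Prod>j\<in>{1..t}. fact (s j)) * a ^ (l - t) *
      fps_nth (fps_powr (- a) (- (real l + 1)) * fps_powr v (1 - real t)) (card A - l))"
proof -
  define C where "C = {z \<in> A. c z \<noteq> 0}"
  define R where "R = {z \<in> A. c z = 0}"
  have AR: "A = C \<union> R" "C \<inter> R = {}" "finite C" "finite R"
    using fin by (auto simp: C_def R_def)
  have BC: "{z \<in> C. c z = j} = {z \<in> A. c z = j}" if "j \<in> {1..t}" for j
    using that by (auto simp: C_def)
  have colC: "c z \<in> {1..t}" if "z \<in> C" for z
    using that col[of z] by (auto simp: C_def)
  have "C = (\<Union>j\<in>{1..t}. {z \<in> C. c z = j})"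
    using colC by auto
  then have "card C = card (\<Union>j\<in>{1..t}. {z \<in> C. c z = j})" by simp
  also have "\<dots> = (\<Sum>j\<in>{1..t}. card {z \<in> C. c z = j})"
    using AR by (intro card_UN_disjoint) auto
  also have "\<dots> = l" using l s BC by simp
  finally have "card C = l" .
  moreover have "card A = card C + card R"
    using AR card_Un_disjoint[of C R] by simp
  ultimately have "card R = card A - l" by simp
  moreover have "separated_gf C c = fps_const ((\<Prod>j\<in>{1..t}. fact (s j)) * a ^ (l - t)) *
    (fps_powr (- a) (- (real l + 1)) * fps_powr v (1 - real t))"
    unfolding l by (rule separated_gf_coloured) (use AR colC BC ne s in auto)
  moreover have "separated_gf A c = (fps_deriv ^^ card R) (separated_gf C c)"
    unfolding AR(1) by (rule separated_gf_free[OF AR(4,3,2)]) (simp add: R_def)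
  ultimately have "fps_nth (separated_gf A c) 0 =
    fact (card A - l) * ((\<Prod>j\<in>{1..t}. fact (s j)) * a ^ (l - t) *
      fps_nth (fps_powr (- a) (- (real l + 1)) * fps_powr v (1 - real t)) (card A - l))"
    by (simp add: fps_0th_higher_deriv del: of_nat_add)
  moreover have "fps_nth (separated_gf A c) 0 =
      (\<Sum>Y\<in>Pow A. separated_sum A c Y * (a ^ card (A - Y) * v ^ card Y))"
    by (simp add: separated_gf_def block_def fps_sum_nth)
  ultimately show ?thesis by simp
qed

end

subsection \<open>The expansion of the integral\<close>

lemma has_integral_power_Beta:
  "((\<lambda>u::real. (1 - u) ^ p * u ^ q) has_integral fact p * fact q / fact (p + q + 1)) {0..1}"
proof -
  have "((\<lambda>t::real. t powr (real q + 1 - 1) * (1 - t) powr (real p + 1 - 1)) has_integral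
      Beta (real q + 1) (real p + 1)) {0..1}"
    by (rule has_integral_Beta_real) auto
  moreover have "Beta (real q + 1) (real p + 1) = fact p * fact q / fact (p + q + 1)"
    using Gamma_fact[of q, where 'a = real] Gamma_fact[of p, where 'a = real]
      Gamma_fact[of "p + q + 1", where 'a = real]
    by (simp add: Beta_def add_ac)
  ultimately show ?thesis
    \<comment> \<open>The endpoints are dropped because \<open>0 powr 0 = 0\<close>, whereas
      \<open>0 ^ 0 = 1\<close>.\<close>
    unfolding has_integral_Icc_iff_Ioo
    by (subst has_integral_cong[where g = "\<lambda>t. t powr (real q + 1 - 1) * (1 - t) powr (real p + 1 - 1)"])
      (auto simp: powr_realpow)
qed

text \<open>The exponent \<open>m + 1 / 2\<close> is a compromise: the remainder is \<open>O(w ^ (m + 1))\<close> for small and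
  \<open>O(w ^ m)\<close> for large \<open>w\<close>, and with \<open>w = z u / (1 - u)\<close> the half power keeps the bound integrable
  at \<open>u = 1\<close> while still gaining a factor \<open>sqrt z\<close>.\<close>

lemma binomial_series_remainder:
  obtains C where "C \<ge> 0"
    "\<And>w. w \<ge> 0 \<Longrightarrow> \<bar>1 / (1 + w) ^ n - (\<Sum>k\<le>m. (- real n gchoose k) * w ^ k)\<bar> \<le> C * (w ^ m * sqrt w)"
proof -
  define c where "c k = (- real n) gchoose k" for k
  define C where "C = \<bar>c (Suc m)\<bar> + (1 + (\<Sum>k\<le>m. \<bar>c k\<bar>))"
  define r where "r w = 1 / (1 + w) ^ n - (\<Sum>k\<le>m. c k * w ^ k)" for w :: real
  have small: "\<bar>r w\<bar> \<le> \<bar>c (Suc m)\<bar> * w ^ Suc m" if "w \<ge> 0" for w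
  proof (cases "w = 0")
    case True
    then show ?thesis
      by (simp add: r_def c_def sum.atMost_shift)
  next
    case False
    \<comment> \<open>The \<open>k\<close>-th derivative of \<open>(1 + x) powr (- n)\<close>, for
      Taylor's formula with Lagrange remainder.\<close>
    define D where "D k x = (fact k * c k) * (1 + x) powr (- real n - real k)" for k and x :: real
    have D: "DERIV (D k) x :> D (Suc k) x" if "0 \<le> x" for k x
    proof -
      have e: "fact (Suc k) * c (Suc k) = (fact k * c k) * (- real n - real k)"
        unfolding c_def gbinomial_mult_fact by simp
      have "D (Suc k) x = (fact k * c k) * ((- real n - real k) * (1 + x) powr (- real n - real k - 1))"
        unfolding D_def e by (simp add: algebra_simps)
      then show ?thesis
        unfolding D_def using that by (auto intro!: derivative_eq_intros)
    qed
    have D0: "D 0 x = 1 / (1 + x) ^ n" if "x \<ge> 0" for x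
      using that by (simp add: D_def c_def powr_minus powr_realpow divide_inverse)
    have "\<exists>x>0. x < w \<and>
      D 0 w = (\<Sum>k<Suc m. D k 0 / fact k * w ^ k) + D (Suc m) x / fact (Suc m) * w ^ Suc m"
      by (rule Maclaurin) (use D that False in auto)
    then obtain x where x: "0 < x" "x < w"
      "D 0 w = (\<Sum>k<Suc m. D k 0 / fact k * w ^ k) + D (Suc m) x / fact (Suc m) * w ^ Suc m"
      by blast
    have "(\<Sum>k<Suc m. D k 0 / fact k * w ^ k) = (\<Sum>k\<le>m. c k * w ^ k)"
      by (intro sum.cong) (auto simp: D_def)
    then have "r w = D (Suc m) x / fact (Suc m) * w ^ Suc m"
      using x(3) D0[OF that] by (simp add: r_def)
    also have "\<dots> = c (Suc m) * (1 + x) powr (- real n - real (Suc m)) * w ^ Suc m"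
      by (simp add: D_def del: fact_Suc)
    finally have "\<bar>r w\<bar> = \<bar>c (Suc m)\<bar> * (1 + x) powr (- real n - real (Suc m)) * w ^ Suc m"
      using that by (simp add: abs_mult)
    also have "\<dots> \<le> \<bar>c (Suc m)\<bar> * 1 * w ^ Suc m"
    proof (intro mult_right_mono mult_left_mono)
      show "(1 + x) powr (- real n - real (Suc m)) \<le> 1"
        using x powr_mono[of "- real n - real (Suc m)" 0 "1 + x"] by simp
    qed (use that in auto)
    finally show ?thesis by simp
  qed
  have "\<bar>r w\<bar> \<le> C * (w ^ m * sqrt w)" if "w \<ge> 0" for w
  proof (cases "w \<le> 1")
    case True
    have "w \<le> sqrt w"
      using that True by (metis mult.left_neutral mult_right_mono real_sqrt_ge_zero real_sqrt_le_1_iff real_sqrt_mult_self abs_of_nonneg)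
    then have "w ^ Suc m \<le> w ^ m * sqrt w"
      using that mult_right_mono[of w "sqrt w" "w ^ m"] by (simp add: mult_ac)
    moreover have "\<bar>c (Suc m)\<bar> \<le> C"
      by (simp add: C_def sum_nonneg add_nonneg_nonneg)
    ultimately have "\<bar>c (Suc m)\<bar> * w ^ Suc m \<le> C * (w ^ m * sqrt w)"
      using that by (intro mult_mono) auto
    with small[OF that] show ?thesis by linarith
  next
    case False
    then have w: "w \<ge> 1" by simp
    have "1 / (1 + w) ^ n \<le> 1" using w by (simp add: divide_le_eq)
    moreover have "1 \<le> w ^ m" using w by simp
    moreover have "1 / (1 + w) ^ n \<ge> 0" using w by simp
    ultimately have "\<bar>1 / (1 + w) ^ n\<bar> \<le> w ^ m" by linarith
    moreover have "\<bar>\<Sum>k\<le>m. c k * w ^ k\<bar> \<le> (\<Sum>k\<le>m. \<bar>c k\<bar> * w ^ m)"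
      using w by (intro order_trans[OF sum_abs] sum_mono) (simp add: abs_mult mult_left_mono power_increasing)
    ultimately have "\<bar>r w\<bar> \<le> (1 + (\<Sum>k\<le>m. \<bar>c k\<bar>)) * w ^ m"
      using abs_triangle_ineq4[of "1 / (1 + w) ^ n" "\<Sum>k\<le>m. c k * w ^ k"]
      unfolding r_def distrib_right sum_distrib_right by linarith
    also have "\<dots> \<le> C * (w ^ m * sqrt w)"
    proof (intro mult_mono)
      show "w ^ m \<le> w ^ m * sqrt w"
        using w by simp
    qed (use w in \<open>auto simp: C_def sum_nonneg add_nonneg_nonneg\<close>)
    finally show ?thesis .
  qed
  moreover have "C \<ge> 0" by (simp add: C_def sum_nonneg add_nonneg_nonneg)
  ultimately show ?thesis
    using that[of C] unfolding r_def c_def by blast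
qed

text \<open>With \<open>w = z u / (1 - u)\<close> the integrand becomes
  \<open>(1 - u) ^ m * u ^ d / (1 + w) ^ (l + 1)\<close>. The term of order \<open>k\<close> of the
  binomial series contains \<open>(1 - u) ^ (m - k)\<close> and is integrable only for
  \<open>k \<le> m\<close>, which is where the expansion stops.\<close>

lemma integral_expansion:
  fixes l m d :: nat
  defines "F \<equiv> \<lambda>z. integral {0..1} (\<lambda>u. (1 - u) ^ (m + l + 1) * u ^ d / (1 - u + z * u) ^ (l + 1))"
  shows "(\<lambda>z. F z - (\<Sum>k\<le>m. (- real (l + 1) gchoose k) *
      (fact (m - k) * fact (d + k) / fact (d + m + 1)) * z ^ k)) \<in> o[at_right 0](\<lambda>z::real. z ^ m)"
proof -
  define c where "c k = (- real (l + 1)) gchoose k" for k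
  define B where "B k = (fact (m - k) * fact (d + k) / fact (d + m + 1) :: real)" for k
  obtain C where C: "C \<ge> 0"
    "\<And>w. w \<ge> 0 \<Longrightarrow> \<bar>1 / (1 + w) ^ (l + 1) - (\<Sum>k\<le>m. c k * w ^ k)\<bar> \<le> C * (w ^ m * sqrt w)"
    unfolding c_def using binomial_series_remainder by blast
  have bound: "\<bar>F z - (\<Sum>k\<le>m. c k * B k * z ^ k)\<bar> \<le> C * Beta 1 (1 / 2) * (z ^ m * sqrt z)" if z: "z > 0" for z
  proof -
    define K where "K u = (1 - u) ^ (m + l + 1) * u ^ d / (1 - u + z * u) ^ (l + 1)" for u
    define h where "h u = K u - (\<Sum>k\<le>m. c k * z ^ k * ((1 - u) ^ (m - k) * u ^ (d + k)))" for u
    have pos: "1 - u + z * u > 0" if "0 \<le> u" "u \<le> 1" for u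
    proof (cases "u = 1")
      case False
      then show ?thesis using that z by (intro add_pos_nonneg) auto
    qed (use z in simp)
    have "continuous_on {0..1} K"
      unfolding K_def using pos by (intro continuous_intros) (auto simp: less_imp_neq[symmetric])
    then have "K integrable_on {0..1}"
      by (rule integrable_continuous_interval)
    then have "(K has_integral F z) {0..1}"
      unfolding F_def K_def by (rule integrable_integral)
    moreover have "((\<lambda>u. \<Sum>k\<le>m. c k * z ^ k * ((1 - u) ^ (m - k) * u ^ (d + k))) has_integral
        (\<Sum>k\<le>m. c k * z ^ k * B k)) {0..1}"
    proof (intro has_integral_sum has_integral_mult_right)
      fix k assume "k \<in> {..m}"
      then have e: "m - k + (d + k) + 1 = d + m + 1" by simp
      show "((\<lambda>u. (1 - u) ^ (m - k) * u ^ (d + k)) has_integral B k) {0..1}"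
        using has_integral_power_Beta[of "m - k" "d + k"] unfolding e B_def .
    qed simp
    ultimately have "(h has_integral (F z - (\<Sum>k\<le>m. c k * z ^ k * B k))) {0..1}"
      unfolding h_def by (rule has_integral_diff)
    then have h: "(h has_integral (F z - (\<Sum>k\<le>m. c k * B k * z ^ k))) {0<..<1}"
      unfolding has_integral_Icc_iff_Ioo by (simp add: mult_ac)
    \<comment> \<open>The integrable majorant: \<open>sqrt w\<close> leaves
      \<open>1 / sqrt (1 - u)\<close>, whose integral is \<open>Beta 1 (1 / 2)\<close>. The open
      interval keeps \<open>w\<close> meaningful.\<close>
    define g where "g u = C * (z ^ m * sqrt z) * (u powr (1 - 1) * (1 - u) powr (1 / 2 - 1))" for u
    have "(g has_integral C * (z ^ m * sqrt z) * Beta 1 (1 / 2)) {0..1}"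
      unfolding g_def by (intro has_integral_mult_right has_integral_Beta_real) auto
    then have g: "(g has_integral C * (z ^ m * sqrt z) * Beta 1 (1 / 2)) {0<..<1}"
      unfolding has_integral_Icc_iff_Ioo .
    have "norm (h u) \<le> g u" if u: "u \<in> {0<..<1}" for u
    proof -
      define w where "w = z * u / (1 - u)"
      have u': "0 < u" "u < 1" "0 < 1 - u" using u by auto
      have w: "w \<ge> 0" using u' z by (simp add: w_def)
      have wu: "(1 - u) * w = z * u" using u' by (simp add: w_def)
      have "1 - u + z * u = (1 - u) * (1 + w)"
        unfolding distrib_left wu by simp
      then have "K u = (1 - u) ^ m * u ^ d * ((1 - u) ^ (l + 1) / ((1 - u) * (1 + w)) ^ (l + 1))"
        by (simp add: K_def power_add)
      also have "(1 - u) ^ (l + 1) / ((1 - u) * (1 + w)) ^ (l + 1) = 1 / (1 + w) ^ (l + 1)"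
        using u' by (simp add: power_mult_distrib)
      finally have K: "K u = (1 - u) ^ m * u ^ d * (1 / (1 + w) ^ (l + 1))" .
      have "z ^ k * ((1 - u) ^ (m - k) * u ^ (d + k)) = (1 - u) ^ m * u ^ d * w ^ k" if "k \<le> m" for k
      proof -
        have "(1 - u) ^ m = (1 - u) ^ (m - k) * (1 - u) ^ k"
          using that by (simp flip: power_add)
        then have "(1 - u) ^ m * u ^ d * w ^ k = (1 - u) ^ (m - k) * u ^ d * ((1 - u) * w) ^ k"
          by (simp only: power_mult_distrib mult_ac)
        then show ?thesis
          unfolding wu by (simp only: power_mult_distrib power_add mult_ac)
      qed
      then have "(\<Sum>k\<le>m. c k * z ^ k * ((1 - u) ^ (m - k) * u ^ (d + k))) =
          (1 - u) ^ m * u ^ d * (\<Sum>k\<le>m. c k * w ^ k)"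
        unfolding sum_distrib_left by (intro sum.cong) (auto simp: mult_ac)
      then have "h u = (1 - u) ^ m * u ^ d * (1 / (1 + w) ^ (l + 1) - (\<Sum>k\<le>m. c k * w ^ k))"
        unfolding h_def K right_diff_distrib by simp
      then have "norm (h u) = (1 - u) ^ m * u ^ d * \<bar>1 / (1 + w) ^ (l + 1) - (\<Sum>k\<le>m. c k * w ^ k)\<bar>"
        using u' by (simp add: abs_mult)
      also have "\<dots> \<le> (1 - u) ^ m * 1 * (C * (w ^ m * sqrt w))"
        using u' C w by (intro mult_mono C(2)) (auto simp: power_le_one)
      also have "\<dots> = C * (((1 - u) * w) ^ m * sqrt w)"
        by (simp add: power_mult_distrib mult_ac)
      also have "\<dots> = C * ((z * u) ^ m * (sqrt (z * u) * (1 - u) powr (1 / 2 - 1)))"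
      proof -
        have "(1 - u) powr (1 / 2 - 1) = inverse (sqrt (1 - u))"
          using u' powr_minus[of "1 - u" "1 / 2"] by (simp add: powr_half_sqrt)
        moreover have "sqrt w = sqrt (z * u) * inverse (sqrt (1 - u))"
          unfolding w_def real_sqrt_divide by (simp only: divide_inverse)
        ultimately show ?thesis by (simp only: wu)
      qed
      also have "\<dots> \<le> C * (z ^ m * (sqrt z * (1 - u) powr (1 / 2 - 1)))"
        using u' z C by (intro mult_left_mono mult_mono power_mono mult_right_mono)
          (auto simp: mult_le_cancel_left2)
      also have "\<dots> = g u"
        using u' by (simp add: g_def)
      finally show ?thesis .
    qed
    then have "norm (integral {0<..<1} h) \<le> integral {0<..<1} g"
      by (intro integral_norm_bound_integral) (use h g in \<open>auto simp: integrable_on_def\<close>)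
    then show ?thesis
      using integral_unique[OF h] integral_unique[OF g] by (simp add: mult_ac)
  qed
  have pos: "eventually (\<lambda>z::real. z > 0) (at_right 0)"
    by (simp add: eventually_at_right_less)
  have "((\<lambda>z::real. C * Beta 1 (1 / 2) * sqrt z) \<longlongrightarrow> C * Beta 1 (1 / 2) * sqrt 0) (at_right 0)"
    by (intro tendsto_intros)
  then have "((\<lambda>z::real. C * Beta 1 (1 / 2) * sqrt z) \<longlongrightarrow> 0) (at_right 0)"
    by simp
  then have "((\<lambda>z. (F z - (\<Sum>k\<le>m. c k * B k * z ^ k)) / z ^ m) \<longlongrightarrow> 0) (at_right 0)"
  proof (rule Lim_null_comparison[rotated])
    show "\<forall>\<^sub>F z in at_right 0. norm ((F z - (\<Sum>k\<le>m. c k * B k * z ^ k)) / z ^ m) \<le> C * Beta 1 (1 / 2) * sqrt z"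
      using pos
    proof eventually_elim
      case (elim z)
      then show ?case
        using bound[OF elim] by (simp add: abs_divide divide_le_eq mult_ac)
    qed
  qed
  then show ?thesis
    unfolding c_def B_def
    by (rule smalloI_tendsto) (use pos in eventually_elim, simp)
qed

section \<open>The power of \<open>1 - z\<close> and the coefficient of the product\<close>

lemma fps_powr_of_nat: "fps_powr c (real n) = (1 + fps_const c * fps_X) ^ n"
proof (induction n)
  case (Suc n)
  have "real (Suc n) = 1 + real n" by simp
  then show ?case
    by (simp only: fps_powr_add fps_powr_1 Suc.IH power_Suc)
qed simp

lemma fps_X_minus: "1 + fps_const (- 1) * fps_X = (1 - fps_X :: real fps)"
  by (simp flip: fps_const_neg)

lemma has_fps_expansion_powi:
  "(\<lambda>z::real. (1 - z) powi (- int t + 1)) has_fps_expansion fps_powr (- 1) (1 - real t)"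
proof (cases t)
  case 0
  have "(\<lambda>z::real. 1 - z) has_fps_expansion (1 - fps_X)"
    by (intro fps_expansion_intros)
  with 0 show ?thesis by (simp add: fps_powr_1 fps_X_minus del: fps_const_neg)
next
  case (Suc n)
  have pow: "(\<lambda>z::real. (1 - z) ^ n) has_fps_expansion (1 - fps_X) ^ n" for n
  proof (induction n)
    case (Suc n)
    have "(\<lambda>z::real. (1 - z) * (1 - z) ^ n) has_fps_expansion (1 - fps_X) * (1 - fps_X) ^ n"
      by (intro fps_expansion_intros Suc.IH)
    then show ?case by simp
  qed simp
  have "fps_powr (- 1) (real n) * fps_powr (- 1) (- real n) = 1"
    using fps_powr_add[of "- 1" "real n" "- real n"] by simp
  then have "fps_powr (- 1) (- real n) = inverse ((1 - fps_X) ^ n)"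
    unfolding fps_powr_of_nat fps_X_minus by (metis fps_inverse_unique)
  moreover have "(\<lambda>z::real. inverse ((1 - z) ^ n)) has_fps_expansion inverse ((1 - fps_X) ^ n)"
    by (intro has_fps_expansion_inverse pow) simp
  ultimately show ?thesis
    using Suc by (simp add: power_int_minus)
qed

lemma has_expansion_coeff_add_smallo:
  assumes "has_expansion_coeff F m c" "H \<in> o[at_right 0](\<lambda>z. z ^ m)"
  shows "has_expansion_coeff (\<lambda>z. F z + H z) m c"
proof -
  obtain a where a: "a m = c" "(\<lambda>z. F z - (\<Sum>k\<le>m. a k * z ^ k)) \<in> o[at_right 0](\<lambda>z. z ^ m)"
    using assms(1) unfolding has_expansion_coeff_def by blast
  have "(\<lambda>z. F z + H z - (\<Sum>k\<le>m. a k * z ^ k)) \<in> o[at_right 0](\<lambda>z. z ^ m)"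
    using sum_in_smallo(1)[OF a(2) assms(2)] by (simp add: algebra_simps)
  with a(1) show ?thesis
    unfolding has_expansion_coeff_def by blast
qed

text \<open>The integral is no power series, so it is replaced by its expansion polynomial. The
  error stays negligible after multiplication by the other factor, which has a limit at 0, and the
  coefficient becomes that of a product of formal power series.\<close>

lemma expansion_coeff_integral:
  fixes l m d t :: nat
  shows "expansion_coeff m (\<lambda>z. (1 - z) powi (- int t + 1) *
      integral {0..1} (\<lambda>u. (1 - u) ^ (m + l + 1) * u ^ d / (1 - u + z * u) ^ (l + 1))) =
    (\<Sum>k\<le>m. (- real (l + 1) gchoose k) * (fact (m - k) * fact (d + k) / fact (d + m + 1)) *
      ((- 1) ^ (m - k) * (1 - real t gchoose (m - k))))"
proof -
  define F where "F z = integral {0..1} (\<lambda>u. (1 - u) ^ (m + l + 1) * u ^ d / (1 - u + z * u) ^ (l + 1))" for z :: real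
  define G where "G z = (1 - z) powi (- int t + 1)" for z :: real
  define b where "b k = (- real (l + 1) gchoose k) * (fact (m - k) * fact (d + k) / fact (d + m + 1))" for k
  define P where "P z = (\<Sum>k\<le>m. b k * z ^ k)" for z :: real
  define p where "p = (\<Sum>k\<le>m. fps_const (b k) * fps_X ^ k)"
  have G: "G has_fps_expansion fps_powr (- 1) (1 - real t)"
    unfolding G_def by (rule has_fps_expansion_powi)
  have P: "P has_fps_expansion p"
    unfolding P_def p_def by (intro fps_expansion_intros)
  have "(G \<longlongrightarrow> G 0) (at_right 0)"
    unfolding G_def by (auto intro!: tendsto_eq_intros)
  moreover have "((\<lambda>z. (F z - P z) / z ^ m) \<longlongrightarrow> 0) (at_right 0)"
    using smalloD_tendsto[OF integral_expansion[of m l d]] by (simp add: F_def P_def b_def)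
  ultimately have "((\<lambda>z. G z * ((F z - P z) / z ^ m)) \<longlongrightarrow> G 0 * 0) (at_right 0)"
    by (rule tendsto_mult)
  then have "(\<lambda>z. G z * (F z - P z)) \<in> o[at_right 0](\<lambda>z. z ^ m)"
    by (intro smalloI_tendsto) (simp, use eventually_at_right_less[of "0 :: real"] in eventually_elim, simp)
  moreover have "has_expansion_coeff (\<lambda>z. P z * G z) m (fps_nth (p * fps_powr (- 1) (1 - real t)) m)"
    by (intro expansion_coeff_has_fps_expansion has_fps_expansion_mult G P)
  ultimately have "has_expansion_coeff (\<lambda>z. P z * G z + G z * (F z - P z)) m
      (fps_nth (p * fps_powr (- 1) (1 - real t)) m)"
    by (intro has_expansion_coeff_add_smallo)
  then have "has_expansion_coeff (\<lambda>z. G z * F z) m (fps_nth (p * fps_powr (- 1) (1 - real t)) m)"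
    by (simp add: algebra_simps)
  then have "expansion_coeff m (\<lambda>z. G z * F z) = fps_nth (p * fps_powr (- 1) (1 - real t)) m"
    by (rule expansion_coeff_eqI)
  also have "\<dots> = (\<Sum>k\<le>m. fps_nth p k * fps_nth (fps_powr (- 1) (1 - real t)) (m - k))"
    by (simp add: fps_mult_nth atMost_atLeast0)
  also have "\<dots> = (\<Sum>k\<le>m. b k * ((- 1) ^ (m - k) * (1 - real t gchoose (m - k))))"
    by (intro sum.cong refl) (simp add: p_def fps_sum_nth fps_powr_nth if_distrib cong: if_cong)
  finally show ?thesis
    by (simp add: F_def G_def b_def)
qed

subsection \<open>The separation probability\<close>

lemma long_cycles_eq_full_cycles: "long_cycles N = full_cycles {1..N}"
  by (simp add: long_cycles_def full_cycles_def)

text \<open>For disjoint sets at most one summand is nonzero, so the sum selects the index of the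
  set containing \<open>z\<close> and defaults to 0; indices start at 1, so 0 is free for
  this.\<close>

definition colour :: "nat \<Rightarrow> (nat \<Rightarrow> nat set) \<Rightarrow> nat \<Rightarrow> nat"
  where "colour t S z = (\<Sum>j\<in>{1..t}. if z \<in> S j then j else 0)"

lemma colour_eq:
  assumes "disjoint_family_on S {1..t}" "j \<in> {1..t}" "z \<in> S j"
  shows "colour t S z = j"
proof -
  have "z \<notin> S i" if "i \<in> {1..t}" "i \<noteq> j" for i
    using disjoint_family_onD[OF assms(1) that(1) assms(2) that(2)] assms(3) by blast
  then have "colour t S z = (\<Sum>i\<in>{1..t}. if i = j then j else 0)"
    unfolding colour_def using assms(3) by (intro sum.cong) auto
  also have "\<dots> = j" using assms(2) by simp
  finally show ?thesis .
qed

lemma colour_cases: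
  assumes "disjoint_family_on S {1..t}"
  obtains "colour t S z = 0" "\<And>j. j \<in> {1..t} \<Longrightarrow> z \<notin> S j"
  | j where "j \<in> {1..t}" "z \<in> S j" "colour t S z = j"
proof (cases "\<exists>j\<in>{1..t}. z \<in> S j")
  case True
  then show ?thesis using that(2) colour_eq[OF assms] by blast
next
  case False
  then have "colour t S z = 0" by (simp add: colour_def)
  with False that(1) show ?thesis by blast
qed

text \<open>In one direction \<open>f\<close> assigns to a cycle the index of a set that it meets,
  unique by separation. In the other, \<open>f\<close> is constant along orbits and equals
  \<open>i\<close> on \<open>S i\<close>, so no orbit meets two of the sets.\<close>

lemma separated_iff_separates:
  assumes disj: "disjoint_family_on S {1..t}" and perm: "\<sigma> permutes {1..N}"
    and sub: "\<And>j. j \<in> {1..t} \<Longrightarrow> S j \<subseteq> {1..N}"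
  shows "separated N t S \<sigma> \<longleftrightarrow> separates {1..N} (colour t S) \<sigma>"
proof
  assume sep: "separated N t S \<sigma>"
  have p: "permutation \<sigma>" using perm permutes_imp_permutation by blast
  define f where "f z = (if \<exists>j\<in>{1..t}. orbit \<sigma> z \<inter> S j \<noteq> {}
    then (SOME j. j \<in> {1..t} \<and> orbit \<sigma> z \<inter> S j \<noteq> {}) else 0)" for z
  have "f (\<sigma> z) = f z" for z
    unfolding f_def permutation_orbit_step[OF p] ..
  moreover have "f z = colour t S z" if z: "z \<in> {1..N}" "colour t S z \<noteq> 0" for z
  proof -
    obtain j where j: "j \<in> {1..t}" "z \<in> S j" "colour t S z = j"
      using colour_cases[OF disj, of z] z(2) by auto
    have "z \<in> orbit \<sigma> z" by (rule permutation_self_in_orbit[OF p])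
    then have meets: "orbit \<sigma> z \<inter> S j \<noteq> {}" using j by blast
    then have "(SOME j. j \<in> {1..t} \<and> orbit \<sigma> z \<inter> S j \<noteq> {}) = j"
      using sep z(1) j(1) unfolding separated_def by (intro some_equality) blast+
    then show ?thesis using meets j by (auto simp: f_def)
  qed
  ultimately show "separates {1..N} (colour t S) \<sigma>"
    unfolding separates_def by blast
next
  assume "separates {1..N} (colour t S) \<sigma>"
  then obtain f where f: "f (\<sigma> z) = f z" "colour t S z \<noteq> 0 \<longrightarrow> f z = colour t S z"
    if "z \<in> {1..N}" for z
    unfolding separates_def by blast
  have orb: "y \<in> {1..N} \<and> f y = f x" if "x \<in> {1..N}" "y \<in> orbit \<sigma> x" for x y
    using that(2)
  proof induction
    case base
    then show ?case using f(1) that(1) permutes_in_image[OF perm] by simp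
  next
    case (step y)
    then show ?case using f(1)[of y] permutes_in_image[OF perm, of y] by simp
  qed
  have "f y = i" if "y \<in> S i" "i \<in> {1..t}" for y i
    using f(2)[of y] colour_eq[OF disj that(2,1)] sub[OF that(2)] that by auto
  with orb show "separated N t S \<sigma>"
    unfolding separated_def by (metis disjoint_iff)
qed

section \<open>From the probability to a count, and the evaluation of the sum\<close>

lemma pair_pmf_of_set:
  assumes "finite A" "A \<noteq> {}" "finite B" "B \<noteq> {}"
  shows "pair_pmf (pmf_of_set A) (pmf_of_set B) = pmf_of_set (A \<times> B)"
proof (rule pmf_eqI)
  fix z
  show "pmf (pair_pmf (pmf_of_set A) (pmf_of_set B)) z = pmf (pmf_of_set (A \<times> B)) z"
    by (cases z) (simp add: pmf_pair pmf_of_set assms card_cartesian_product indicator_def)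
qed

lemma separation_prob_eq:
  assumes "N \<ge> 1"
  shows "separation_prob N t S = (\<Sum>\<sigma> | \<sigma> permutes {1..N} \<and> separated N t S \<sigma>.
    real (cycle_pairs {1..N} \<sigma>)) / (fact (N - 1))\<^sup>2"
proof -
  let ?C = "full_cycles {1..N}"
  let ?P = "{\<sigma>. \<sigma> permutes {1..N} \<and> separated N t S \<sigma>}"
  have ne: "{1..N} \<noteq> {}" using assms by simp
  have card: "card ?C = fact (N - 1)"
    using card_full_cycles[OF _ ne] by simp
  then have C: "finite ?C" "?C \<noteq> {}" by (auto intro: card_ge_0_finite)
  have finP: "finite ?P" by (rule finite_subset[OF _ finite_permutations[of "{1..N}"]]) auto
  have "separation_prob N t S =
      card (?C \<times> ?C \<inter> {(p1, p2). separated N t S (p1 \<circ> p2)}) / card (?C \<times> ?C)"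
    unfolding separation_prob_def long_cycles_eq_full_cycles pair_pmf_of_set[OF C C]
    using C by (simp add: measure_pmf_of_set)
  also have "?C \<times> ?C \<inter> {(p1, p2). separated N t S (p1 \<circ> p2)} =
      (\<Union>\<sigma>\<in>?P. {(p, q). p \<in> ?C \<and> q \<in> ?C \<and> p \<circ> q = \<sigma>})"
    by (auto intro: permutes_compose full_cycles_permutes)
  also have "card \<dots> = (\<Sum>\<sigma>\<in>?P. cycle_pairs {1..N} \<sigma>)"
    unfolding cycle_pairs_def
  proof (rule card_UN_disjoint[OF finP])
    show "\<forall>\<sigma>\<in>?P. finite {(p, q). p \<in> ?C \<and> q \<in> ?C \<and> p \<circ> q = \<sigma>}"
      using C by (auto intro: finite_subset[of _ "?C \<times> ?C"])
  qed auto
  finally show ?thesis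
    using card by (simp add: card_cartesian_product power2_eq_square)
qed

lemma falling_factorial_fact:
  assumes "l \<le> N"
  shows "falling_factorial (real N) l = fact N / fact (N - l)"
  using assms
proof (induction l)
  case (Suc l)
  then have "N - l = Suc (N - Suc l)" by simp
  then have "(fact (N - l) :: real) = (real N - real l) * fact (N - Suc l)"
    using Suc.prems by (simp add: of_nat_diff)
  moreover have "real N - real l \<noteq> 0" using Suc.prems by simp
  moreover have "falling_factorial (real N) (Suc l) = falling_factorial (real N) l * (real N - real l)"
    by (simp add: falling_factorial_def)
  ultimately show ?case
    using Suc by simp
qed (simp add: falling_factorial_def)

lemma sum_signed_invariant_sum_separated:
  assumes "finite A"
  shows "(\<Sum>\<sigma> | \<sigma> permutes A \<and> separates A c \<sigma>. signed_invariant_sum A \<sigma>) =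
    (\<Sum>Y\<in>Pow A. separated_sum A c Y * (fact (card Y) * fact (card A - card Y)))"
proof -
  let ?w = "\<lambda>Y. fact (card Y) * fact (card A - card Y) :: real"
  have fin: "finite {\<sigma>. \<sigma> permutes A}" using assms by (rule finite_permutations)
  have "(\<Sum>\<sigma> | \<sigma> permutes A \<and> separates A c \<sigma>. signed_invariant_sum A \<sigma>) =
      (\<Sum>\<sigma> | \<sigma> permutes A. if separates A c \<sigma> then signed_invariant_sum A \<sigma> else 0)"
    using sum.inter_filter[OF fin, of "signed_invariant_sum A" "separates A c"] by simp
  also have "\<dots> = (\<Sum>\<sigma> | \<sigma> permutes A. \<Sum>Y\<in>Pow A.
      (if \<sigma> ` Y = Y \<and> separates A c \<sigma> then of_int (sign_on Y \<sigma>) else 0) * ?w Y)"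
  proof (rule sum.cong[OF refl])
    fix \<sigma>
    have "invariant_sets A \<sigma> = {Y \<in> Pow A. \<sigma> ` Y = Y}"
      by (auto simp: invariant_sets_def)
    then have "signed_invariant_sum A \<sigma> =
        (\<Sum>Y\<in>Pow A. if \<sigma> ` Y = Y then of_int (sign_on Y \<sigma>) * ?w Y else 0)"
      unfolding signed_invariant_sum_def mult.assoc
      using sum.inter_filter[of "Pow A" "\<lambda>Y. of_int (sign_on Y \<sigma>) * ?w Y" "\<lambda>Y. \<sigma> ` Y = Y"] assms
      by simp
    then show "(if separates A c \<sigma> then signed_invariant_sum A \<sigma> else 0) = (\<Sum>Y\<in>Pow A.
      (if \<sigma> ` Y = Y \<and> separates A c \<sigma> then of_int (sign_on Y \<sigma>) else 0) * ?w Y)"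
      by (auto intro!: sum.cong)
  qed
  also have "\<dots> = (\<Sum>Y\<in>Pow A. separated_sum A c Y * ?w Y)"
    unfolding separated_sum_def sum_distrib_right by (rule sum.swap)
  finally show ?thesis .
qed

text \<open>The polynomial \<open>T\<close> is integrated in two ways: term by term over
  \<open>Y\<close>, which produces the factorial weights divided by
  \<open>fact (card A + 1)\<close>, and in the closed form of \<open>separated_weight\<close> with
  fugacities \<open>1 - u\<close> and \<open>u\<close>.\<close>

lemma separated_sum_total:
  fixes t :: nat and s :: "nat \<Rightarrow> nat"
  assumes fin: "finite A" and col: "\<And>z. z \<in> A \<Longrightarrow> c z \<le> t"
    and ne: "\<And>j. j \<in> {1..t} \<Longrightarrow> {z \<in> A. c z = j} \<noteq> {}"
    and s: "\<And>j. j \<in> {1..t} \<Longrightarrow> card {z \<in> A. c z = j} = s j"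
    and l: "l = (\<Sum>j\<in>{1..t}. s j)" and lA: "card A = m + l"
  shows "(\<Sum>Y\<in>Pow A. separated_sum A c Y * (fact (card Y) * fact (card A - card Y))) =
    fact (card A + 1) * (fact m * (\<Prod>j\<in>{1..t}. fact (s j))) *
    (\<Sum>k\<le>m. (- 1) ^ k * (- real (l + 1) gchoose k) * (1 - real t gchoose (m - k)) *
      (fact (l - t + k) * fact (m - k) / fact (l - t + m + 1)))"
proof -
  let ?P = "fact m * (\<Prod>j\<in>{1..t}. fact (s j)) :: real"
  define T where "T u = (\<Sum>Y\<in>Pow A. separated_sum A c Y * ((1 - u) ^ card (A - Y) * u ^ card Y))" for u
  have "(T has_integral (\<Sum>Y\<in>Pow A. separated_sum A c Y *
      (fact (card (A - Y)) * fact (card Y) / fact (card A + 1)))) {0..1}"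
    unfolding T_def
  proof (intro has_integral_sum has_integral_mult_right)
    fix Y assume "Y \<in> Pow A"
    then have "card (A - Y) + card Y = card A"
      using finite_subset[OF _ fin] card_mono[OF fin, of Y] by (simp add: card_Diff_subset)
    then show "((\<lambda>u::real. (1 - u) ^ card (A - Y) * u ^ card Y) has_integral
      (fact (card (A - Y)) * fact (card Y) / fact (card A + 1) :: real)) {0..1}"
      using has_integral_power_Beta[of "card (A - Y)" "card Y"] by simp
  qed (use fin in simp)
  moreover have "T u = (\<Sum>k\<le>m. ?P * ((- 1) ^ k * (- real (l + 1) gchoose k) * (1 - real t gchoose (m - k))) *
      ((1 - u) ^ (l - t + k) * u ^ (m - k)))" for u
  proof -
    interpret fugacities "1 - u" u by standard simp
    have "T u = fact m * ((\<Prod>j\<in>{1..t}. fact (s j)) * (1 - u) ^ (l - t) *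
      fps_nth (fps_powr (- (1 - u)) (- (real l + 1)) * fps_powr u (1 - real t)) m)"
      using separated_weight[OF fin col ne s l] lA by (simp add: T_def)
    also have "fps_nth (fps_powr (- (1 - u)) (- (real l + 1)) * fps_powr u (1 - real t)) m =
      (\<Sum>k\<le>m. (- (1 - u)) ^ k * (- real (l + 1) gchoose k) * (u ^ (m - k) * (1 - real t gchoose (m - k))))"
      by (simp only: fps_mult_nth fps_powr_nth atMost_atLeast0 of_nat_add of_nat_1)
    finally show ?thesis
      unfolding sum_distrib_left power_minus[of "1 - u"] power_add by (simp only: mult_ac)
  qed
  then have T: "T = (\<lambda>u. \<Sum>k\<le>m. ?P * ((- 1) ^ k * (- real (l + 1) gchoose k) * (1 - real t gchoose (m - k))) *
      ((1 - u) ^ (l - t + k) * u ^ (m - k)))"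
    by blast
  have "(T has_integral (\<Sum>k\<le>m. ?P * ((- 1) ^ k * (- real (l + 1) gchoose k) * (1 - real t gchoose (m - k))) *
      (fact (l - t + k) * fact (m - k) / fact (l - t + m + 1)))) {0..1}"
    unfolding T
  proof (intro has_integral_sum has_integral_mult_right)
    fix k assume "k \<in> {..m}"
    then have e: "l - t + k + (m - k) + 1 = l - t + m + 1" by simp
    show "((\<lambda>u::real. (1 - u) ^ (l - t + k) * u ^ (m - k)) has_integral
      (fact (l - t + k) * fact (m - k) / fact (l - t + m + 1) :: real)) {0..1}"
      using has_integral_power_Beta[of "l - t + k" "m - k"] unfolding e .
  qed simp
  ultimately have "(\<Sum>Y\<in>Pow A. separated_sum A c Y *
      (fact (card (A - Y)) * fact (card Y) / fact (card A + 1))) =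
    (\<Sum>k\<le>m. ?P * ((- 1) ^ k * (- real (l + 1) gchoose k) * (1 - real t gchoose (m - k))) *
      (fact (l - t + k) * fact (m - k) / fact (l - t + m + 1)))"
    by (rule has_integral_unique)
  also have "\<dots> = ?P * (\<Sum>k\<le>m. (- 1) ^ k * (- real (l + 1) gchoose k) * (1 - real t gchoose (m - k)) *
      (fact (l - t + k) * fact (m - k) / fact (l - t + m + 1)))"
    unfolding sum_distrib_left by (simp only: mult.assoc)
  finally have "fact (card A + 1) * (\<Sum>Y\<in>Pow A. separated_sum A c Y *
      (fact (card (A - Y)) * fact (card Y) / fact (card A + 1))) =
    fact (card A + 1) * ?P * (\<Sum>k\<le>m. (- 1) ^ k * (- real (l + 1) gchoose k) * (1 - real t gchoose (m - k)) *
      (fact (l - t + k) * fact (m - k) / fact (l - t + m + 1)))"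
    by (simp only: mult.assoc)
  moreover have "fact (card A + 1) * (\<Sum>Y\<in>Pow A. separated_sum A c Y *
      (fact (card (A - Y)) * fact (card Y) / fact (card A + 1))) =
      (\<Sum>Y\<in>Pow A. separated_sum A c Y * (fact (card Y) * fact (card A - card Y)))"
    unfolding sum_distrib_left
  proof (rule sum.cong[OF refl])
    fix Y assume "Y \<in> Pow A"
    then have "card (A - Y) = card A - card Y"
      using fin finite_subset by (auto intro: card_Diff_subset)
    then show "fact (card A + 1) * (separated_sum A c Y *
        (fact (card (A - Y)) * fact (card Y) / fact (card A + 1))) =
      separated_sum A c Y * (fact (card Y) * fact (card A - card Y))"
      by (simp del: fact_Suc)
  qed
  ultimately show ?thesis by simp
qed

theorem theorem5p2:
  fixes N t l :: nat and S :: "nat \<Rightarrow> nat set" and lv :: "nat \<Rightarrow> nat"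
  assumes "N \<ge> 1"
    and "\<And>j. j \<in> {1..t} \<Longrightarrow> S j \<subseteq> {1..N}"
    and "\<And>j. j \<in> {1..t} \<Longrightarrow> S j \<noteq> {}"
    and "disjoint_family_on S {1..t}"
    and "\<And>j. j \<in> {1..t} \<Longrightarrow> card (S j) = lv j"
    and "l = (\<Sum>j\<in>{1..t}. lv j)"
  shows "separation_prob N t S =
    (-1) ^ (N + l) * real N * (\<Prod>j\<in>{1..t}. fact (lv j)) / falling_factorial (real N) l *
    expansion_coeff (N - l) (\<lambda>z. (1 - z) powi (- int t + 1) *
      integral {0..1} (\<lambda>u. (1 - u) ^ (N + 1) * u ^ (l - t) / (1 - u + z * u) ^ (l + 1)))"
proof -
  let ?A = "{1..N}"
  define c where "c = colour t S"
  define m where "m = N - l"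
  have fin: "finite (S j)" if "j \<in> {1..t}" for j
    using assms(2)[OF that] finite_subset by blast
  have "l = card (\<Union>j\<in>{1..t}. S j)"
    using fin assms(4,5,6)
    by (subst card_UN_disjoint) (auto simp: disjoint_family_on_def)
  also have "\<dots> \<le> card ?A"
    by (intro card_mono UN_least assms(2)) auto
  finally have lN: "l \<le> N" by simp
  then have N: "N = m + l" by (simp add: m_def)
  have level: "{z \<in> ?A. c z = j} = S j" if j: "j \<in> {1..t}" for j
  proof (intro set_eqI iffI)
    fix z assume "z \<in> {z \<in> ?A. c z = j}"
    then show "z \<in> S j"
      using colour_cases[OF assms(4), of z] j by (auto simp: c_def)
  next
    fix z assume "z \<in> S j"
    then show "z \<in> {z \<in> ?A. c z = j}"
      using colour_eq[OF assms(4) j] assms(2)[OF j] by (auto simp: c_def)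
  qed
  have col: "c z \<le> t" for z
    by (rule colour_cases[OF assms(4), of z]) (simp_all add: c_def)
  have nonempty: "{z \<in> ?A. c z = j} \<noteq> {}" and card_level: "card {z \<in> ?A. c z = j} = lv j"
    if "j \<in> {1..t}" for j
    unfolding level[OF that] using assms(3,5)[OF that] by simp_all
  have cN: "card ?A = N" "card ?A = m + l" using N by simp_all
  define K where "K = (\<Sum>k\<le>m. (- 1) ^ k * (- real (l + 1) gchoose k) * (1 - real t gchoose (m - k)) *
      (fact (l - t + k) * fact (m - k) / fact (l - t + m + 1)))"
  define M where "M = (\<Sum>\<sigma> | \<sigma> permutes ?A \<and> separated N t S \<sigma>. real (cycle_pairs ?A \<sigma>))"
  have "real N * real (N + 1) * M =
      (\<Sum>\<sigma> | \<sigma> permutes ?A \<and> separates ?A c \<sigma>. signed_invariant_sum ?A \<sigma>)"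
    unfolding M_def sum_distrib_left
  proof (rule sum.cong)
    show "{\<sigma>. \<sigma> permutes ?A \<and> separated N t S \<sigma>} = {\<sigma>. \<sigma> permutes ?A \<and> separates ?A c \<sigma>}"
      using separated_iff_separates[OF assms(4) _ assms(2)] by (auto simp: c_def)
    show "real N * real (N + 1) * real (cycle_pairs ?A \<sigma>) = signed_invariant_sum ?A \<sigma>"
      if "\<sigma> \<in> {\<sigma>. \<sigma> permutes ?A \<and> separates ?A c \<sigma>}" for \<sigma>
      using cycle_pairs_eq_signed_invariant_sum[of ?A \<sigma>] that assms(1) by simp
  qed
  also have "\<dots> = fact (N + 1) * (fact m * (\<Prod>j\<in>{1..t}. fact (lv j))) * K"
    unfolding sum_signed_invariant_sum_separated[OF finite_atLeastAtMost] K_def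
    using separated_sum_total[OF finite_atLeastAtMost col nonempty card_level assms(6) cN(2)]
    unfolding cN(1) .
  \<comment> \<open>This isolates the factor \<open>N (N + 1)\<close> of the factorisation formula;
    the remaining \<open>fact (N - 1)\<close> cancels one of the two in the probability.\<close>
  also have "(fact (N + 1) :: real) = real N * real (N + 1) * fact (N - 1)"
    using assms(1) by (cases N) (simp_all add: mult_ac)
  finally have "M = fact (N - 1) * (fact m * (\<Prod>j\<in>{1..t}. fact (lv j))) * K"
    using assms(1) by (simp add: mult.assoc)
  then have "separation_prob N t S = fact m * (\<Prod>j\<in>{1..t}. fact (lv j)) * K / fact (N - 1)"
    unfolding separation_prob_eq[OF assms(1)] M_def[symmetric]
    by (simp add: power2_eq_square)
  also have "\<dots> = real N * (\<Prod>j\<in>{1..t}. fact (lv j)) / falling_factorial (real N) l * K"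
  proof -
    have "(fact N :: real) = real N * fact (N - 1)"
      using assms(1) by (simp add: fact_reduce)
    then show ?thesis
      using assms(1) unfolding falling_factorial_fact[OF lN] m_def[symmetric]
      by (simp add: field_simps)
  qed
  also have "K = (- 1) ^ (N + l) * expansion_coeff m (\<lambda>z. (1 - z) powi (- int t + 1) *
      integral {0..1} (\<lambda>u. (1 - u) ^ (m + l + 1) * u ^ (l - t) / (1 - u + z * u) ^ (l + 1)))"
    unfolding expansion_coeff_integral K_def sum_distrib_left
  proof (rule sum.cong[OF refl])
    fix k assume "k \<in> {..m}"
    then obtain i where "m = k + i" using le_iff_add by auto
    \<comment> \<open>Since \<open>N + l = m + 2 l\<close>, the global sign has the parity of
      \<open>m\<close>; it is the trace of the sign in the substitution for
      \<open>z\<close>.\<close>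
    then have "(- 1 :: real) ^ k = (- 1) ^ (N + l) * (- 1) ^ (m - k)"
      unfolding N by (simp add: power_add flip: mult.assoc power_mult_distrib)
    then show "(- 1) ^ k * (- real (l + 1) gchoose k) * (1 - real t gchoose (m - k)) *
        (fact (l - t + k) * fact (m - k) / fact (l - t + m + 1)) =
      (- 1) ^ (N + l) * ((- real (l + 1) gchoose k) *
        (fact (m - k) * fact (l - t + k) / fact (l - t + m + 1)) *
        ((- 1) ^ (m - k) * (1 - real t gchoose (m - k))))"
      by (simp only: mult_ac)
  qed
  finally show ?thesis
    unfolding m_def[symmetric] N[symmetric] by (simp add: mult_ac)
qed

end
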